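(* Let $K$ be a non-polar compact subset of $\mathbb{C}$ and let $\mu$ be a unit Borel measure supported on a compact set containing $\partial\Omega_K$. Let $\mu_s$ denote the singular part of $\mu$ with respect to $\mu_K$ and let $h$ be a non-negative measurable function on $\partial\Omega_K$ such that (1) $d\mu = h\,d\mu_K + d\mu_s$; (2) $M := \int \log h \, d\mu_K > -\infty$; (3) $\mathrm{Cap}(\mathrm{supp}(\mu)) = \mathrm{Cap}(\mathrm{supp}(\mu_K))$. Then $\inf_{n\in\mathbb{N}} (W_n(\mu))^2 \geq e^M$.
   Context: $\mathrm{Cap}(\cdot)$ denotes logarithmic capacity; a compact set is non-polar if its capacity is positive. For a non-polar compact set $K\subset\mathbb{C}$, $\mu_K$ is its equilibrium measure and $\Omega_K$ is the connected component of $\overline{\mathbb{C}}\setminus K$ containing $\infty$. One has $\mathrm{Cap}(\mathrm{supp}(\mu_K))=\mathrm{Cap}(K)$. A unit Borel measure is a Borel probability measure on $\mathbb{C}$, and $\mathrm{supp}(\mu)$ is the support of $\mu$. For a unit Borel measure $\mu$ with infinite compact support, $P_n(\cdot;\mu)$ is the $n$-th degree monic orthogonal polynomial for $\mu$, i.e. the monic polynomial of degree $n$ with $\|P_n(\cdot;\mu)\|_{L^2(\mathbb{C};\mu)}=\inf_{Q}\|Q\|_{L^2(\mathbb{C};\mu)}$, the infimum being over all monic complex polynomials $Q$ of degree $n$. Define $$W_n(\mu):=\frac{\|P_n(\cdot;\mu)\|_{L^2(\mathbb{C};\mu)}}{\mathrm{Cap}(\mathrm{supp}(\mu))^n}.$$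 *)

theory Defs
  imports "HOL-Probability.Probability" "HOL-Computational_Algebra.Polynomial"
begin

(* Real ln has the junk value ln 0 = 0; elog is the extended logarithm with log 0 = -\<infinity>,
   and eexp the corresponding exponential. *)
definition elog :: "real \<Rightarrow> ereal"
  where "elog x = (if x \<le> 0 then -\<infinity> else ereal (ln x))"

definition eexp :: "ereal \<Rightarrow> ereal"
  where "eexp x = (if x = \<infinity> then \<infinity> else if x = -\<infinity> then 0 else ereal (exp (real_of_ereal x)))"

(* Integral of an extended-real function, positive part minus negative part. It is only
   meaningful when one of the two is finite; ereal has \<infinity> - \<infinity> = \<infinity>, but all uses below
   have an integrand with a finite integral of the positive or of the negative part. *)
definition ereal_integral :: "'a measure \<Rightarrow> ('a \<Rightarrow> ereal) \<Rightarrow> ereal"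
  where "ereal_integral N f =
    enn2ereal (\<integral>\<^sup>+x. e2ennreal (f x) \<partial>N) - enn2ereal (\<integral>\<^sup>+x. e2ennreal (- f x) \<partial>N)"

definition unit_borel_measure :: "complex measure \<Rightarrow> bool"
  where "unit_borel_measure \<nu> \<longleftrightarrow> prob_space \<nu> \<and> sets \<nu> = sets borel"

definition unit_measures_on :: "complex set \<Rightarrow> complex measure set"
  where "unit_measures_on S = {\<nu>. unit_borel_measure \<nu> \<and> emeasure \<nu> (- S) = 0}"

definition measure_supp :: "complex measure \<Rightarrow> complex set"
  where "measure_supp \<nu> = {z. \<forall>U. open U \<longrightarrow> z \<in> U \<longrightarrow> emeasure \<nu> U > 0}"

(* The kernel is log (1 / |z - w|), equal to \<infinity> on the diagonal. *)
definition log_energy :: "complex measure \<Rightarrow> ereal"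
  where "log_energy \<nu> =
    ereal_integral \<nu> (\<lambda>z. ereal_integral \<nu> (\<lambda>w. - elog (cmod (z - w))))"

(* Intended for compact K. There the infimum lies in (-\<infinity>, \<infinity>], so the capacity is a real
   number; it is 0 exactly when no unit measure on K has finite energy. *)
definition log_capacity :: "complex set \<Rightarrow> real"
  where "log_capacity K = real_of_ereal (eexp (- (INF \<nu>\<in>unit_measures_on K. log_energy \<nu>)))"

definition non_polar :: "complex set \<Rightarrow> bool"
  where "non_polar K \<longleftrightarrow> log_capacity K > 0"

(* For a non-polar compact K there is exactly one such \<nu> (Frostman). *)
definition is_equilibrium_measure :: "complex set \<Rightarrow> complex measure \<Rightarrow> bool"
  where "is_equilibrium_measure K \<nu> \<longleftrightarrow>
    \<nu> \<in> unit_measures_on K \<and> (\<forall>\<nu>'\<in>unit_measures_on K. log_energy \<nu> \<le> log_energy \<nu>')"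

(* The Riemann sphere is the one-point compactification of the plane; None is the point at
   infinity. *)
definition riemann_sphere :: "complex option topology"
  where "riemann_sphere = Alexandroff_compactification euclidean"

definition Omega :: "complex set \<Rightarrow> complex option set"
  where "Omega K =
    connected_component_of_set (subtopology riemann_sphere (- Some ` K)) None"

(* For compact K, infinity is an interior point of Omega K, so its boundary in the sphere
   consists of finite points; here it is read as a subset of the plane. *)
definition boundary_Omega :: "complex set \<Rightarrow> complex set"
  where "boundary_Omega K = Some -` (riemann_sphere frontier_of Omega K)"

definition mutually_singular :: "complex measure \<Rightarrow> complex measure \<Rightarrow> bool"
  where "mutually_singular \<nu> \<rho> \<longleftrightarrow>
    (\<exists>N\<in>sets borel. emeasure \<nu> N = 0 \<and> emeasure \<rho> (- N) = 0)"

definition L2_norm_poly :: "complex measure \<Rightarrow> complex poly \<Rightarrow> real"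
  where "L2_norm_poly \<mu> Q = sqrt (\<integral>z. (cmod (poly Q z))\<^sup>2 \<partial>\<mu>)"

definition monic_polys :: "nat \<Rightarrow> complex poly set"
  where "monic_polys n = {Q. degree Q = n \<and> lead_coeff Q = 1}"

definition monic_OP :: "complex measure \<Rightarrow> nat \<Rightarrow> complex poly"
  where "monic_OP \<mu> n =
    (THE P. P \<in> monic_polys n \<and> L2_norm_poly \<mu> P = (INF Q\<in>monic_polys n. L2_norm_poly \<mu> Q))"

definition widom_factor :: "nat \<Rightarrow> complex measure \<Rightarrow> real"
  where "widom_factor n \<mu> = L2_norm_poly \<mu> (monic_OP \<mu> n) / log_capacity (measure_supp \<mu>) ^ n"

end

theory Submission
  imports Defs "HOL-Complex_Analysis.Cauchy_Integral_Formula"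
    "HOL-Computational_Algebra.Fundamental_Theorem_Algebra"
begin

text \<open>
Write \<open>\<mu>\<^sub>K\<close> for the equilibrium measure, \<open>U\<close> for its logarithmic potential and
\<open>I\<close> for its energy, so that the capacity of \<open>K\<close> is \<open>exp (- I)\<close>. For a monic polynomial \<open>P\<close>
of degree \<open>n\<close> with zeros \<open>z\<^sub>1, \<dots>, z\<^sub>n\<close>, Jensen's inequality for the probability measure
\<open>\<mu>\<^sub>K\<close> gives
\<open>\<integral>|P|\<^sup>2 d\<mu> \<ge> \<integral>|P|\<^sup>2 h d\<mu>\<^sub>K \<ge> exp (\<integral> log h d\<mu>\<^sub>K - 2 (U z\<^sub>1 + \<dots> + U z\<^sub>n))\<close>,
and the right-hand side is at least \<open>exp (M - 2 n I)\<close> as soon as \<open>U \<le> I\<close> on the whole plane. Applied to the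
monic orthogonal polynomial this is the assertion (\<open>weighted_L2_lower_bound\<close>). The same bound shows
that the \<open>L\<^sup>2\<close> seminorm is definite on polynomials, so that the minimising monic polynomial exists
and is unique (\<open>monic_OP_in_monic_polys\<close>).

Two facts of potential theory are needed. The first is the upper half of Frostman's theorem, \<open>U \<le> I\<close>
everywhere. Perturbing \<open>\<mu>\<^sub>K\<close> towards its normalised restriction to \<open>{U < I}\<close> shows that \<open>U = I\<close>
almost everywhere (\<open>AE_log_pot_eq\<close>); lower semicontinuity gives \<open>U \<le> I\<close> on the support
(\<open>log_pot_le_supp\<close>); and a maximum principle carries the bound to the rest of the plane
(\<open>\<phi>_le_energy\<close>).

The second is that \<open>\<mu>\<^sub>K\<close> is concentrated on the outer boundary of \<open>K\<close> (\<open>AE_boundary\<close>); without it the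
integral defining \<open>M\<close> could miss some of the mass, and Jensen's inequality would not apply. Let \<open>V\<close> be the
complement of the closure of the outer domain. Any \<open>z\<close> in \<open>V\<close> has a harmonic measure \<open>\<nu>\<close> on the outer boundary,
with potential at most \<open>log (1 / |w - z|)\<close> at \<open>w\<close>. It has finite energy, so the variational inequality
\<open>I \<le> \<integral> U d\<nu>\<close> holds, and by symmetry the right-hand side is at most \<open>U z\<close>. Hence \<open>U \<ge> I\<close> on \<open>V\<close>. If \<open>V\<close> met the
support at \<open>y\<close>, the mean of \<open>U\<close> over a small circle about \<open>y\<close> would be at least \<open>I\<close>, yet strictly smaller than
\<open>U y \<le> I\<close>. The harmonic measure is built as the law of the limit of a walk on spheres
(\<open>exists_harmonic_measure\<close>), whose convergence comes from the orthogonality of its increments.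
\<close>

section \<open>The logarithmic kernel\<close>

text \<open>
The logarithmic kernel shifted by a constant \<open>C\<close> and truncated at \<open>0\<close>.
With \<open>C\<close> chosen so large that all relevant distances are at most \<open>exp C\<close>,
the truncation is invisible and potentials and energies become integrals of non-negative functions;
the true values are recovered by subtracting \<open>C\<close>.
\<close>

definition log_kernel :: "real \<Rightarrow> complex \<Rightarrow> complex \<Rightarrow> ennreal"
  where "log_kernel C z w = (if z = w then \<infinity> else ennreal (C - ln (dist z w)))"

text \<open>
The potential of \<open>\<nu>\<close>, shifted by \<open>C\<close> (for a probability measure).
\<close>

definition log_pot :: "real \<Rightarrow> complex measure \<Rightarrow> complex \<Rightarrow> ennreal"
  where "log_pot C \<nu> z = (\<integral>\<^sup>+w. log_kernel C z w \<partial>\<nu>)"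

text \<open>
The energy of \<open>\<nu>\<close>, shifted by \<open>C\<close>.
\<close>

definition log_en :: "real \<Rightarrow> complex measure \<Rightarrow> ennreal"
  where "log_en C \<nu> = (\<integral>\<^sup>+z. log_pot C \<nu> z \<partial>\<nu>)"

lemma log_kernel_commute: "log_kernel C z w = log_kernel C w z"
  by (auto simp: log_kernel_def dist_commute)

lemma log_kernel_measurable [measurable]:
  "(\<lambda>p. log_kernel C (fst p) (snd p)) \<in> borel_measurable (borel \<Otimes>\<^sub>M borel)"
proof -
  have "(\<lambda>p::complex\<times>complex. if dist (fst p) (snd p) = 0 then \<infinity>
      else ennreal (C - ln (dist (fst p) (snd p)))) \<in> borel_measurable (borel \<Otimes>\<^sub>M borel)"
    by measurable
  then show ?thesis by (simp add: log_kernel_def)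
qed

lemma log_kernel_measurable' [measurable]:
  assumes [measurable]: "f \<in> borel_measurable M" "g \<in> borel_measurable M"
  shows "(\<lambda>x. log_kernel C (f x) (g x)) \<in> borel_measurable M"
  using measurable_compose[OF measurable_Pair[OF assms] log_kernel_measurable] by simp

lemma log_kernel_eq_e2ennreal:
  "log_kernel C z w = e2ennreal (- elog (cmod (z - w)) + ereal C)"
  by (auto simp: log_kernel_def elog_def dist_norm ennreal_def e2ennreal_infty algebra_simps
      max_def e2ennreal_neg) 

text \<open>
The kernel is continuous as an extended-valued function, also on the diagonal; with Fatou's lemma
this yields lower semicontinuity of potentials.
\<close>

lemma tendsto_log_kernel:
  assumes "x \<longlonglongrightarrow> z" "y \<longlonglongrightarrow> w"
  shows "(\<lambda>n. log_kernel C (x n) (y n)) \<longlonglongrightarrow> log_kernel C z w"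
proof -
  have d: "(\<lambda>n. dist (x n) (y n)) \<longlonglongrightarrow> dist z w"
    using assms by (intro tendsto_intros)
  show ?thesis
  proof (cases "z = w")
    case False
    then have "eventually (\<lambda>n. 0 < dist (x n) (y n)) sequentially"
      using order_tendstoD(1)[OF d, of 0] by (simp del: zero_less_dist_iff)
    then have ev: "eventually (\<lambda>n. log_kernel C (x n) (y n) = ennreal (C - ln (dist (x n) (y n)))) sequentially"
      by eventually_elim (auto simp: log_kernel_def)
    have "(\<lambda>n. ennreal (C - ln (dist (x n) (y n)))) \<longlonglongrightarrow> ennreal (C - ln (dist z w))"
      using False by (intro tendsto_ennrealI tendsto_intros d) auto
    then show ?thesis
      using False tendsto_cong[OF ev] by (simp add: log_kernel_def)
  next
    case True
    have "(\<lambda>n. log_kernel C (x n) (y n)) \<longlonglongrightarrow> top"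
    proof (rule order_tendstoI)
      fix a :: ennreal assume "a < top"
      then obtain b where b: "a = ennreal b" "b \<ge> 0" by (cases a) auto
      have "eventually (\<lambda>n. dist (x n) (y n) < exp (C - b - 1)) sequentially"
        using order_tendstoD(2)[OF d] True by simp
      then show "eventually (\<lambda>n. a < log_kernel C (x n) (y n)) sequentially"
      proof eventually_elim
        case (elim n)
        show ?case
        proof (cases "x n = y n")
          case False
          then have "ln (dist (x n) (y n)) < C - b - 1"
            using elim by (metis ln_exp ln_less_cancel_iff exp_gt_zero zero_less_dist_iff)
          then show ?thesis using False b by (auto simp: log_kernel_def intro!: ennreal_lessI)
        qed (use \<open>a < top\<close> in \<open>simp add: log_kernel_def\<close>)
      qed
    qed simp
    then show ?thesis using True by (simp add: log_kernel_def)
  qed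
qed

lemma log_pot_measurable [measurable]:
  assumes "sets \<nu> = sets borel" "sigma_finite_measure \<nu>"
  shows "log_pot C \<nu> \<in> borel_measurable borel"
proof -
  note [measurable_cong] = assms(1)
  interpret sigma_finite_measure \<nu> by fact
  show ?thesis unfolding log_pot_def by measurable
qed

lemma ereal_integral_cong_AE:
  assumes "AE x in N. f x = g x"
  shows "ereal_integral N f = ereal_integral N g"
proof -
  have "(\<integral>\<^sup>+x. e2ennreal (f x) \<partial>N) = (\<integral>\<^sup>+x. e2ennreal (g x) \<partial>N)"
    "(\<integral>\<^sup>+x. e2ennreal (- f x) \<partial>N) = (\<integral>\<^sup>+x. e2ennreal (- g x) \<partial>N)"
    using assms by (auto intro!: nn_integral_cong_AE elim!: eventually_mono)
  then show ?thesis by (simp add: ereal_integral_def)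
qed

text \<open>
The integral of a function bounded below by \<open>- C\<close> is the integral of the non-negative
function \<open>f + C\<close>, minus \<open>C\<close>.
\<close>

lemma ereal_integral_shift:
  assumes "prob_space N" and [measurable]: "f \<in> borel_measurable N" and "C \<ge> 0"
    and AE: "AE x in N. - ereal C \<le> f x"
  shows "ereal_integral N f = enn2ereal (\<integral>\<^sup>+x. e2ennreal (f x + ereal C) \<partial>N) - ereal C"
proof -
  interpret prob_space N by fact
  let ?pos = "\<integral>\<^sup>+x. e2ennreal (f x) \<partial>N" and ?neg = "\<integral>\<^sup>+x. e2ennreal (- f x) \<partial>N"
  let ?sh = "\<integral>\<^sup>+x. e2ennreal (f x + ereal C) \<partial>N"
  have real: "ennreal (r + C) + ennreal (- r) = ennreal r + ennreal C" if "- C \<le> r" for r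
  proof (cases "r \<ge> 0")
    case True
    then show ?thesis using \<open>C \<ge> 0\<close> by (simp add: ennreal_neg)
  next
    case False
    then have "ennreal (r + C) + ennreal (- r) = ennreal (r + C + - r)"
      using that by (intro ennreal_plus[symmetric]) auto
    then show ?thesis using False by (simp add: ennreal_neg)
  qed
  have eq: "e2ennreal (y + ereal C) + e2ennreal (- y) = e2ennreal y + ennreal C" if "- ereal C \<le> y" for y
    using that by (cases y) (auto simp: real e2ennreal_infty)
  have "?sh + ?neg = (\<integral>\<^sup>+x. e2ennreal (f x + ereal C) + e2ennreal (- f x) \<partial>N)"
    by (rule nn_integral_add[symmetric]) measurable
  also have "\<dots> = (\<integral>\<^sup>+x. e2ennreal (f x) + ennreal C \<partial>N)"
    using AE by (intro nn_integral_cong_AE) (auto elim!: eventually_mono simp: eq)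
  also have "\<dots> = ?pos + ennreal C"
    by (subst nn_integral_add) (auto simp: emeasure_space_1)
  finally have e: "?sh + ?neg = ?pos + ennreal C" .
  have "?neg \<le> (\<integral>\<^sup>+x. ennreal C \<partial>N)"
    using AE
  proof (intro nn_integral_mono_AE, eventually_elim)
    case (elim x)
    then have "- f x \<le> ereal C" by (metis ereal_minus_le_minus ereal_uminus_uminus)
    then show ?case by (metis e2ennreal_mono ennreal_def assms(3) max_absorb2 e2ennreal_ereal ereal_less_eq(5))
  qed
  then have "?neg \<le> ennreal C" by (simp add: emeasure_space_1)
  then obtain b where b: "?neg = ennreal b" "b \<ge> 0" by (cases ?neg) (auto simp: top_unique)
  show ?thesis
    using e \<open>C \<ge> 0\<close> b unfolding ereal_integral_def
    by (cases ?pos; cases ?sh) (auto simp: ennreal_plus[symmetric] enn2ereal_ennreal simp del: ennreal_plus)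
qed

lemma log_energy_eq:
  assumes "prob_space \<nu>" "sets \<nu> = sets borel" "AE z in \<nu>. cmod z \<le> R" "2 * R \<le> exp C" "C \<ge> 0"
  shows "log_energy \<nu> = enn2ereal (log_en C \<nu>) - ereal C"
proof -
  note [measurable_cong] = assms(2)
  interpret prob_space \<nu> by fact
  have m: "(\<lambda>w. - elog (cmod (z - w))) \<in> borel_measurable \<nu>" for z
    unfolding elog_def by measurable
  have lower: "- ereal C \<le> - elog (cmod (z - w))" if "cmod z \<le> R" "cmod w \<le> R" for z w
  proof -
    have "cmod (z - w) \<le> exp C" using norm_triangle_ineq4[of z w] that assms(4) by simp
    then have "cmod (z - w) > 0 \<Longrightarrow> ln (cmod (z - w)) \<le> C" by (metis ln_exp ln_le_cancel_iff exp_gt_zero)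
    then show ?thesis by (auto simp: elog_def)
  qed
  have inner: "ereal_integral \<nu> (\<lambda>w. - elog (cmod (z - w))) = enn2ereal (log_pot C \<nu> z) - ereal C"
    if "cmod z \<le> R" for z
    unfolding log_pot_def log_kernel_eq_e2ennreal
    using assms(3) that by (intro ereal_integral_shift m assms) (auto intro: lower[unfolded uminus_ereal.simps] elim!: eventually_mono)
  have [measurable]: "log_pot C \<nu> \<in> borel_measurable borel"
    by (intro log_pot_measurable assms) unfold_locales
  have "log_energy \<nu> = ereal_integral \<nu> (\<lambda>z. enn2ereal (log_pot C \<nu> z) - ereal C)"
    unfolding log_energy_def
    using assms(3) by (intro ereal_integral_cong_AE) (auto elim!: eventually_mono simp: inner)
  also have "\<dots> = enn2ereal (\<integral>\<^sup>+z. e2ennreal (enn2ereal (log_pot C \<nu> z) - ereal C + ereal C) \<partial>\<nu>) - ereal C"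
  proof (intro ereal_integral_shift assms)
    show "AE z in \<nu>. - ereal C \<le> enn2ereal (log_pot C \<nu> z) - ereal C"
    proof (intro AE_I2)
      fix z show "- ereal C \<le> enn2ereal (log_pot C \<nu> z) - ereal C"
        using enn2ereal_nonneg[of "log_pot C \<nu> z"] by (cases "enn2ereal (log_pot C \<nu> z)") auto
    qed
  qed measurable
  also have "(\<lambda>z. e2ennreal (enn2ereal (log_pot C \<nu> z) - ereal C + ereal C)) = log_pot C \<nu>"
  proof
    fix z
    have "enn2ereal (log_pot C \<nu> z) - ereal C + ereal C = enn2ereal (log_pot C \<nu> z)"
      by (cases "enn2ereal (log_pot C \<nu> z)") auto
    then show "e2ennreal (enn2ereal (log_pot C \<nu> z) - ereal C + ereal C) = log_pot C \<nu> z" by simp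
  qed
  finally show ?thesis by (simp add: log_en_def)
qed

section \<open>Variation of the energy minimiser\<close>

lemma prob_sets_unit_measures_on:
  assumes "\<nu> \<in> unit_measures_on K"
  shows "prob_space \<nu>" "sets \<nu> = sets borel" "emeasure \<nu> (- K) = 0"
  using assms by (auto simp: unit_measures_on_def unit_borel_measure_def)

lemma AE_unit_measures_on:
  assumes "\<nu> \<in> unit_measures_on K" "closed K"
  shows "AE z in \<nu>. z \<in> K"
  by (rule AE_I[of _ _ "- K"]) (use assms prob_sets_unit_measures_on[OF assms(1)] in auto)

lemma log_pot_swap:
  assumes "sets \<mu> = sets borel" "sigma_finite_measure \<mu>" "sets \<nu> = sets borel" "sigma_finite_measure \<nu>"
  shows "(\<integral>\<^sup>+z. log_pot C \<mu> z \<partial>\<nu>) = (\<integral>\<^sup>+w. log_pot C \<nu> w \<partial>\<mu>)"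
proof -
  note [measurable_cong] = assms(1,3)
  interpret pair_sigma_finite \<mu> \<nu> using assms by (simp add: pair_sigma_finite_def)
  have "(\<integral>\<^sup>+z. log_pot C \<mu> z \<partial>\<nu>) = (\<integral>\<^sup>+z. (\<integral>\<^sup>+w. log_kernel C w z \<partial>\<mu>) \<partial>\<nu>)"
    by (simp add: log_pot_def log_kernel_commute)
  also have "\<dots> = (\<integral>\<^sup>+w. (\<integral>\<^sup>+z. log_kernel C w z \<partial>\<nu>) \<partial>\<mu>)"
    by (rule Fubini'[where f="\<lambda>w z. log_kernel C w z"]) (simp add: case_prod_beta)
  finally show ?thesis by (simp add: log_pot_def)
qed

text \<open>
The convex combination \<open>(1 - t) \<mu> + t \<nu>\<close>, realised by choosing one of the two
measures with a Bernoulli variable.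
\<close>

definition mixture :: "real \<Rightarrow> complex measure \<Rightarrow> complex measure \<Rightarrow> complex measure"
  where "mixture t \<mu> \<nu> = measure_pmf (bernoulli_pmf t) \<bind> (\<lambda>b. if b then \<nu> else \<mu>)"

context
  fixes \<mu> \<nu> :: "complex measure" and t :: real
  assumes prob: "prob_space \<mu>" "prob_space \<nu>"
    and sets: "sets \<mu> = sets borel" "sets \<nu> = sets borel"
    and t: "0 < t" "t < 1"
begin

lemma mixture_kernel: "(\<lambda>b. if b then \<nu> else \<mu>) \<in> measurable (measure_pmf (bernoulli_pmf t)) (prob_algebra borel)"
  using prob sets by (simp add: space_prob_algebra measurable_pmf_measure1)

lemma sets_mixture: "sets (mixture t \<mu> \<nu>) = sets borel"
  unfolding mixture_def using measurable_prob_algebraD[OF mixture_kernel]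
  by (rule sets_bind_measurable) simp

lemma prob_space_mixture: "prob_space (mixture t \<mu> \<nu>)"
  unfolding mixture_def
  by (rule prob_space_bind'[OF _ mixture_kernel]) (simp add: space_prob_algebra measure_pmf.prob_space_axioms)

lemma nn_integral_mixture:
  assumes f: "f \<in> borel_measurable borel"
  shows "(\<integral>\<^sup>+z. f z \<partial>mixture t \<mu> \<nu>) = ennreal (1 - t) * (\<integral>\<^sup>+z. f z \<partial>\<mu>) + ennreal t * (\<integral>\<^sup>+z. f z \<partial>\<nu>)"
proof -
  have "(\<integral>\<^sup>+z. f z \<partial>mixture t \<mu> \<nu>)
      = (\<integral>\<^sup>+b. (\<integral>\<^sup>+z. f z \<partial>(if b then \<nu> else \<mu>)) \<partial>measure_pmf (bernoulli_pmf t))"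
    unfolding mixture_def by (rule nn_integral_bind[OF f measurable_prob_algebraD[OF mixture_kernel]])
  also have "\<dots> = ennreal (1 - t) * (\<integral>\<^sup>+z. f z \<partial>\<mu>) + ennreal t * (\<integral>\<^sup>+z. f z \<partial>\<nu>)"
    using t by (simp add: nn_integral_bernoulli_pmf mult.commute add.commute)
  finally show ?thesis .
qed

lemma log_pot_mixture:
  "log_pot C (mixture t \<mu> \<nu>) z = ennreal (1 - t) * log_pot C \<mu> z + ennreal t * log_pot C \<nu> z"
  unfolding log_pot_def by (rule nn_integral_mixture) measurable

lemma log_en_mixture:
  "log_en C (mixture t \<mu> \<nu>) = ennreal ((1 - t)^2) * log_en C \<mu>
     + ennreal (2 * t * (1 - t)) * (\<integral>\<^sup>+z. log_pot C \<mu> z \<partial>\<nu>) + ennreal (t^2) * log_en C \<nu>"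
proof -
  note sf = prob_space_imp_sigma_finite[OF prob(1)] prob_space_imp_sigma_finite[OF prob(2)]
  have [measurable]: "log_pot C \<mu> \<in> borel_measurable borel" "log_pot C \<nu> \<in> borel_measurable borel"
    using sf sets by auto
  note [measurable_cong] = sets
  have [measurable]: "log_pot C (mixture t \<mu> \<nu>) \<in> borel_measurable borel"
    by (intro log_pot_measurable sets_mixture prob_space_imp_sigma_finite prob_space_mixture)
  have swap: "(\<integral>\<^sup>+z. log_pot C \<nu> z \<partial>\<mu>) = (\<integral>\<^sup>+z. log_pot C \<mu> z \<partial>\<nu>)"
    using log_pot_swap sf sets by metis
  define a b d where "a = log_en C \<mu>" "b = (\<integral>\<^sup>+z. log_pot C \<mu> z \<partial>\<nu>)" "d = log_en C \<nu>"
  have "log_en C (mixture t \<mu> \<nu>) =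
     ennreal (1 - t) * (ennreal (1 - t) * a + ennreal t * b) + ennreal t * (ennreal (1 - t) * b + ennreal t * d)"
    unfolding log_en_def[of _ "mixture t \<mu> \<nu>"]
    by (simp add: nn_integral_mixture log_pot_mixture[abs_def] nn_integral_add nn_integral_cmult swap a_b_d_def log_en_def)
  also have "\<dots> = (ennreal (1 - t) * ennreal (1 - t)) * a + (2 * (ennreal t * ennreal (1 - t))) * b + (ennreal t * ennreal t) * d"
    by (simp add: algebra_simps mult_2 distrib_left distrib_right)
  also have "2 * (ennreal t * ennreal (1 - t)) = ennreal (2 * t * (1 - t))"
    using t by (simp add: ennreal_mult mult.assoc)
  finally show ?thesis using t by (simp add: a_b_d_def power2_eq_square ennreal_mult)
qed

end

text \<open>
A measure \<open>\<mu>\<close> of finite minimal energy on a compact subset \<open>K\<close> of the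
disc of radius \<open>R\<close> about the origin. The bound \<open>2 * R \<le> exp C\<close> makes
the kernel with shift \<open>C\<close> untruncated on \<open>K\<close>.
\<close>

locale energy_minimizer =
  fixes K :: "complex set" and \<mu> :: "complex measure" and C R :: real
  assumes compact: "compact K"
    and K_cball: "K \<subseteq> cball 0 R"
    and radius: "2 * R \<le> exp C"
    and C_nonneg: "0 \<le> C"
    and on_K: "\<mu> \<in> unit_measures_on K"
    and minimal: "\<And>\<nu>. \<nu> \<in> unit_measures_on K \<Longrightarrow> log_en C \<mu> \<le> log_en C \<nu>"
    and finite: "log_en C \<mu> < \<infinity>"
begin

sublocale prob_space \<mu>
  using on_K by (rule prob_sets_unit_measures_on)

lemma sets_\<mu> [measurable_cong, simp]: "sets \<mu> = sets borel"
  using on_K by (rule prob_sets_unit_measures_on)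

lemma space_\<mu> [simp]: "space \<mu> = UNIV"
  using sets_eq_imp_space_eq[OF sets_\<mu>] by simp

lemma closed_K: "closed K"
  using compact by (rule compact_imp_closed)

lemma AE_K: "AE z in \<mu>. z \<in> K"
  using on_K closed_K by (rule AE_unit_measures_on)

lemma log_pot_\<mu>_measurable [measurable]: "log_pot C \<mu> \<in> borel_measurable borel"
  by (rule log_pot_measurable) (auto intro: sigma_finite_measure_axioms)

text \<open>
The variational inequality: the derivative at \<open>t = 0\<close> of the energy of \<open>(1 - t)
\<mu> + t \<nu>\<close> is non-negative.
\<close>

lemma energy_le_integral_log_pot:
  assumes \<nu>: "\<nu> \<in> unit_measures_on K" and fin: "log_en C \<nu> < \<infinity>"
  shows "log_en C \<mu> \<le> (\<integral>\<^sup>+z. log_pot C \<mu> z \<partial>\<nu>)"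
proof (cases "(\<integral>\<^sup>+z. log_pot C \<mu> z \<partial>\<nu>) = \<infinity>")
  case False
  note prob = prob_space_axioms prob_sets_unit_measures_on(1)[OF \<nu>]
    and sets = sets_\<mu> prob_sets_unit_measures_on(2)[OF \<nu>]
  obtain D where D: "(\<integral>\<^sup>+z. log_pot C \<mu> z \<partial>\<nu>) = ennreal D" "D \<ge> 0"
    using False by (cases "\<integral>\<^sup>+z. log_pot C \<mu> z \<partial>\<nu>") auto
  obtain E where E: "log_en C \<mu> = ennreal E" "E \<ge> 0"
    using finite by (cases "log_en C \<mu>") auto
  obtain F where F: "log_en C \<nu> = ennreal F" "F \<ge> 0"
    using fin by (cases "log_en C \<nu>") auto
  have ineq: "2 * E \<le> t * E + 2 * (1 - t) * D + t * F" if t: "0 < t" "t < 1" for t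
  proof -
    have "emeasure (mixture t \<mu> \<nu>) (- K) = 0"
    proof -
      have "emeasure (mixture t \<mu> \<nu>) (- K) = (\<integral>\<^sup>+z. indicator (- K) z \<partial>mixture t \<mu> \<nu>)"
        using closed_K sets_mixture[OF prob sets t] by (intro nn_integral_indicator[symmetric]) auto
      also have "\<dots> = 0"
        using closed_K prob_sets_unit_measures_on[OF \<nu>] prob_sets_unit_measures_on[OF on_K]
        by (subst nn_integral_mixture[OF prob sets t]) auto
      finally show ?thesis .
    qed
    then have "mixture t \<mu> \<nu> \<in> unit_measures_on K"
      by (auto simp: unit_measures_on_def unit_borel_measure_def prob_space_mixture[OF prob sets t]
          sets_mixture[OF prob sets t])
    then have "ennreal E \<le> ennreal ((1 - t)^2 * E + 2 * t * (1 - t) * D + t^2 * F)"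
      using minimal[of "mixture t \<mu> \<nu>"] t E D F
      by (simp add: log_en_mixture[OF prob sets t] ennreal_mult[symmetric] ennreal_plus[symmetric] del: ennreal_plus)
    then have "E \<le> (1 - t)^2 * E + 2 * t * (1 - t) * D + t^2 * F"
      using E D F t by (subst (asm) ennreal_le_iff) auto
    then have "t * (2 * E) \<le> t * (t * E + 2 * (1 - t) * D + t * F)"
      by (simp add: power2_eq_square algebra_simps)
    then show ?thesis using t by simp
  qed
  have "2 * E \<le> 2 * D"
  proof (rule tendsto_lowerbound)
    show "((\<lambda>t. t * E + 2 * (1 - t) * D + t * F) \<longlongrightarrow> 2 * D) (at_right 0)"
      by (auto intro!: tendsto_eq_intros)
    show "\<forall>\<^sub>F t in at_right 0. 2 * E \<le> t * E + 2 * (1 - t) * D + t * F"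
      using ineq by (auto simp: eventually_at_right_field intro: exI[of _ 1])
  qed simp
  then show ?thesis using E D by simp
qed simp

text \<open>
The mean of the potential is the energy. If the potential were smaller on a set \<open>G\<close> of
positive measure, the restriction of \<open>\<mu>\<close> to \<open>G\<close> would violate the
variational inequality; hence it is nowhere smaller, and then it is equal, almost everywhere.
\<close>

lemma AE_log_pot_eq: "AE z in \<mu>. log_pot C \<mu> z = log_en C \<mu>"
proof -
  define E where "E = log_en C \<mu>"
  have int: "(\<integral>\<^sup>+z. log_pot C \<mu> z \<partial>\<mu>) = E" by (simp add: E_def log_en_def)
  have Efin: "E \<noteq> \<infinity>" using finite by (simp add: E_def)
  define G where "G = {z. log_pot C \<mu> z < E}"
  have [measurable]: "G \<in> sets borel" unfolding G_def by measurable
  have "emeasure \<mu> G = 0"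
  proof (rule ccontr)
    assume pos: "emeasure \<mu> G \<noteq> 0"
    define \<nu> where "\<nu> = uniform_measure \<mu> G"
    have Gfin: "emeasure \<mu> G \<noteq> \<infinity>" by simp
    have [simp]: "sets \<nu> = sets borel" by (simp add: \<nu>_def)
    have prob: "prob_space \<nu>" unfolding \<nu>_def using pos Gfin by (rule prob_space_uniform_measure)
    have le: "(\<integral>\<^sup>+z. f z \<partial>\<nu>) \<le> (\<integral>\<^sup>+z. f z \<partial>\<mu>) / emeasure \<mu> G" if "f \<in> borel_measurable borel" for f
      unfolding \<nu>_def using that
      by (subst nn_integral_uniform_measure) (auto intro!: divide_right_mono_ennreal nn_integral_mono simp: indicator_def)
    have "emeasure \<nu> (- K) = 0"
      using closed_K prob_sets_unit_measures_on(3)[OF on_K] le[of "indicator (- K)"]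
      by (simp add: ennreal_zero_divide)
    then have \<nu>K: "\<nu> \<in> unit_measures_on K"
      using prob by (simp add: unit_measures_on_def unit_borel_measure_def)
    have [measurable]: "log_pot C \<nu> \<in> borel_measurable borel"
      by (intro log_pot_measurable prob_space_imp_sigma_finite prob) simp
    have "log_pot C \<nu> z \<le> log_pot C \<mu> z / emeasure \<mu> G" for z
      unfolding log_pot_def by (rule le) measurable
    then have "log_en C \<nu> \<le> (\<integral>\<^sup>+z. log_pot C \<mu> z / emeasure \<mu> G \<partial>\<nu>)"
      unfolding log_en_def by (intro nn_integral_mono)
    also have "\<dots> \<le> (\<integral>\<^sup>+z. log_pot C \<mu> z / emeasure \<mu> G \<partial>\<mu>) / emeasure \<mu> G"
      by (rule le) measurable
    also have "\<dots> = E / emeasure \<mu> G / emeasure \<mu> G"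
      by (subst nn_integral_divide) (auto simp: int)
    also have "\<dots> < \<infinity>" using Efin pos by (auto simp: ennreal_divide_eq_top_iff less_top[symmetric])
    finally have "E \<le> (\<integral>\<^sup>+z. log_pot C \<mu> z \<partial>\<nu>)"
      using energy_le_integral_log_pot[OF \<nu>K] by (simp add: E_def)
    moreover have "(\<integral>\<^sup>+z. log_pot C \<mu> z \<partial>\<nu>) < (\<integral>\<^sup>+z. E \<partial>\<nu>)"
    proof (rule nn_integral_less)
      have AE: "AE z in \<nu>. z \<in> G"
        unfolding \<nu>_def by (rule AE_uniform_measureI) auto
      show "(\<integral>\<^sup>+z. log_pot C \<mu> z \<partial>\<nu>) \<noteq> \<infinity>"
      proof -
        have "(\<integral>\<^sup>+z. log_pot C \<mu> z \<partial>\<nu>) \<le> E / emeasure \<mu> G"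
          using le[OF log_pot_\<mu>_measurable] by (simp add: int)
        also have "\<dots> < \<infinity>" using Efin pos by (auto simp: ennreal_divide_eq_top_iff less_top[symmetric])
        finally show ?thesis by simp
      qed
      show "AE z in \<nu>. log_pot C \<mu> z \<le> E"
        using AE by eventually_elim (auto simp: G_def)
      show "\<not> (AE z in \<nu>. E \<le> log_pot C \<mu> z)"
      proof
        assume "AE z in \<nu>. E \<le> log_pot C \<mu> z"
        with AE have "AE z in \<nu>. False" by eventually_elim (auto simp: G_def)
        then show False using prob_space.AE_False[OF prob] by simp
      qed
      show "log_pot C \<mu> \<in> borel_measurable \<nu>"
        using log_pot_\<mu>_measurable by (simp cong: measurable_cong_sets)
    qed simp
    ultimately show False
      using prob_space.emeasure_space_1[OF prob] by simp
  qed
  then have ge: "AE z in \<mu>. E \<le> log_pot C \<mu> z"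
    by (intro AE_I[of _ _ G]) (auto simp: G_def not_le)
  have "AE z in \<mu>. log_pot C \<mu> z \<le> E"
  proof (rule ccontr)
    assume "\<not> (AE z in \<mu>. log_pot C \<mu> z \<le> E)"
    then have "(\<integral>\<^sup>+z. E \<partial>\<mu>) < (\<integral>\<^sup>+z. log_pot C \<mu> z \<partial>\<mu>)"
      using ge Efin emeasure_space_1 by (intro nn_integral_less) (auto simp: emeasure_space_1)
    then show False using emeasure_space_1 by (simp add: int)
  qed
  with ge show ?thesis by eventually_elim (simp add: E_def)
qed

lemma no_atoms: "emeasure \<mu> {z} = 0"
proof (rule ccontr)
  assume pos: "emeasure \<mu> {z} \<noteq> 0"
  have "log_pot C \<mu> z \<noteq> \<infinity>"
  proof
    assume inf: "log_pot C \<mu> z = \<infinity>"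
    have "AE x in \<mu>. x \<noteq> z"
      using AE_log_pot_eq by eventually_elim (use inf finite in auto)
    then show False using pos by (simp add: AE_iff_measurable[OF _ refl])
  qed
  moreover have "log_pot C \<mu> z \<ge> (\<integral>\<^sup>+w. \<infinity> * indicator {z} w \<partial>\<mu>)"
    unfolding log_pot_def by (intro nn_integral_mono) (auto simp: log_kernel_def indicator_def)
  moreover have "(\<integral>\<^sup>+w. \<infinity> * indicator {z} w \<partial>\<mu>) = \<infinity>"
    using pos by (subst nn_integral_cmult_indicator) (auto simp: ennreal_top_mult)
  ultimately show False by (simp add: top_unique)
qed

lemma log_pot_lsc:
  assumes "x \<longlonglongrightarrow> z"
  shows "log_pot C \<mu> z \<le> liminf (\<lambda>n. log_pot C \<mu> (x n))"
proof -
  have "log_pot C \<mu> z = (\<integral>\<^sup>+w. liminf (\<lambda>n. log_kernel C (x n) w) \<partial>\<mu>)"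
    unfolding log_pot_def
    by (intro nn_integral_cong lim_imp_Liminf[symmetric] tendsto_log_kernel assms) auto
  also have "\<dots> \<le> liminf (\<lambda>n. log_pot C \<mu> (x n))"
    unfolding log_pot_def by (intro nn_integral_liminf) measurable
  finally show ?thesis .
qed

lemma log_pot_le_supp:
  assumes "z \<in> measure_supp \<mu>"
  shows "log_pot C \<mu> z \<le> log_en C \<mu>"
proof -
  have "\<exists>x. dist x z < inverse (Suc n) \<and> log_pot C \<mu> x \<le> log_en C \<mu>" for n
  proof (rule ccontr)
    assume "\<nexists>x. dist x z < inverse (Suc n) \<and> log_pot C \<mu> x \<le> log_en C \<mu>"
    then have no: "log_pot C \<mu> x \<noteq> log_en C \<mu>" if "x \<in> ball z (inverse (Suc n))" for x
      using that by (auto simp: dist_commute)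
    have "AE x in \<mu>. x \<notin> ball z (inverse (Suc n))"
      using AE_log_pot_eq by eventually_elim (use no in auto)
    then have "emeasure \<mu> (ball z (inverse (Suc n))) = 0"
      by (simp add: AE_iff_measurable[OF _ refl] ball_def del: of_nat_Suc)
    moreover have "emeasure \<mu> (ball z (inverse (Suc n))) > 0"
      using assms by (auto simp: measure_supp_def simp del: of_nat_Suc)
    ultimately show False by simp
  qed
  then obtain x where x: "\<And>n. dist (x n) z < inverse (Suc n)" "\<And>n. log_pot C \<mu> (x n) \<le> log_en C \<mu>"
    by metis
  have "x \<longlonglongrightarrow> z"
    by (subst tendsto_dist_iff, rule tendsto_sandwich[OF _ _ tendsto_const LIMSEQ_inverse_real_of_nat]) (use less_imp_le[OF x(1)] in \<open>auto simp del: of_nat_Suc\<close>)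
  then have "log_pot C \<mu> z \<le> liminf (\<lambda>n. log_pot C \<mu> (x n))" by (rule log_pot_lsc)
  also have "\<dots> \<le> liminf (\<lambda>n. log_en C \<mu>)" by (intro Liminf_mono always_eventually allI x)
  finally show ?thesis by (simp add: Liminf_const)
qed

end

section \<open>The maximum principle for the equilibrium potential\<close>

lemma closed_measure_supp: "closed (measure_supp \<nu>)"
proof -
  have "- measure_supp \<nu> = \<Union>{U. open U \<and> emeasure \<nu> U = 0}"
    by (auto simp: measure_supp_def)
  then show ?thesis unfolding closed_def by auto
qed

lemma emeasure_compl_measure_supp:
  assumes "sets \<nu> = sets borel"
  shows "emeasure \<nu> (- measure_supp \<nu>) = 0"
proof -
  let ?F = "{U. open U \<and> emeasure \<nu> U = 0}"
  have eq: "- measure_supp \<nu> = \<Union>?F"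
    by (auto simp: measure_supp_def)
  obtain F' where F': "F' \<subseteq> ?F" "countable F'" "\<Union>F' = \<Union>?F"
    using Lindelof[of ?F] by auto
  have "(\<Union>U\<in>F'. U) \<in> null_sets \<nu>"
    using F' assms by (intro null_sets_UN') (auto simp: null_sets_def subset_eq)
  with F' eq show ?thesis by auto
qed

lemma measure_supp_subset:
  assumes "\<nu> \<in> unit_measures_on K" "closed K"
  shows "measure_supp \<nu> \<subseteq> K"
proof
  fix z assume z: "z \<in> measure_supp \<nu>"
  show "z \<in> K"
  proof (rule ccontr)
    assume "z \<notin> K"
    then have "emeasure \<nu> (- K) > 0"
      using z assms(2) by (auto simp: measure_supp_def open_Compl)
    then show False using prob_sets_unit_measures_on(3)[OF assms(1)] by simp
  qed
qed

text \<open>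
An approximate mean value property over the vertices of a square: with \<open>a = x - w\<close> the
product of the four distances is \<open>|a\<^sup>4 - r\<^sup>4|\<close>. The error is of fourth
order in \<open>r\<close>, which is all that the maximum principle needs.
\<close>

lemma sum_ln_dist_square:
  assumes "r < dist x w" "0 \<le> r"
  shows "ln (dist (x + of_real r) w) + ln (dist (x - of_real r) w)
    + ln (dist (x + \<i> * of_real r) w) + ln (dist (x - \<i> * of_real r) w)
    \<le> 4 * ln (dist x w) + r^4 / dist x w ^ 4"
proof -
  define a where "a = x - w"
  have ne: "dist (x + u) w > 0" if "cmod u = r" for u
  proof -
    have "dist x w \<le> dist x (x + u) + dist (x + u) w" by (rule dist_triangle)
    moreover have "dist x (x + u) = r" using that by (simp add: dist_norm)
    ultimately show ?thesis using assms by linarith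
  qed
  have pos: "dist (x + of_real r) w > 0" "dist (x - of_real r) w > 0"
    "dist (x + \<i> * of_real r) w > 0" "dist (x - \<i> * of_real r) w > 0" "dist x w > 0"
    using ne[of "of_real r"] ne[of "- of_real r"] ne[of "\<i> * of_real r"] ne[of "- \<i> * of_real r"] assms
    by (auto simp: norm_mult)
  have "dist (x + u) w = cmod (a + u)" "dist (x - u) w = cmod (a - u)" for u
    by (simp_all add: dist_norm a_def algebra_simps)
  then have "dist (x + of_real r) w * dist (x - of_real r) w * dist (x + \<i> * of_real r) w * dist (x - \<i> * of_real r) w
     = cmod ((a + of_real r) * (a - of_real r) * (a + \<i> * of_real r) * (a - \<i> * of_real r))"
    by (simp only: norm_mult)
  also have "(a + of_real r) * (a - of_real r) * (a + \<i> * of_real r) * (a - \<i> * of_real r)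
      = (a^2 - of_real r ^ 2) * (a^2 - (\<i> * of_real r)^2)"
    by (simp add: algebra_simps power2_eq_square)
  also have "\<dots> = a^4 - of_real r ^ 4"
    by (simp add: algebra_simps power2_eq_square power4_eq_xxxx)
  also have "cmod (a^4 - of_real r ^ 4) \<le> cmod a ^ 4 + r ^ 4"
    using norm_triangle_ineq4[of "a^4" "of_real r ^ 4"] assms(2) by (simp add: norm_power)
  also have "\<dots> = dist x w ^ 4 * (1 + r ^ 4 / dist x w ^ 4)"
    using pos by (simp add: a_def dist_norm field_simps)
  finally have le: "dist (x + of_real r) w * dist (x - of_real r) w * dist (x + \<i> * of_real r) w * dist (x - \<i> * of_real r) w
     \<le> dist x w ^ 4 * (1 + r ^ 4 / dist x w ^ 4)" .
  have q: "0 \<le> r ^ 4 / dist x w ^ 4" by simp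
  have "ln (dist (x + of_real r) w) + ln (dist (x - of_real r) w)
    + ln (dist (x + \<i> * of_real r) w) + ln (dist (x - \<i> * of_real r) w)
    = ln (dist (x + of_real r) w * dist (x - of_real r) w * dist (x + \<i> * of_real r) w * dist (x - \<i> * of_real r) w)"
    using pos by (simp add: ln_mult_pos)
  also have "\<dots> \<le> ln (dist x w ^ 4 * (1 + r ^ 4 / dist x w ^ 4))"
    using pos le by (intro ln_mono mult_pos_pos) auto
  also have "\<dots> = 4 * ln (dist x w) + ln (1 + r ^ 4 / dist x w ^ 4)"
    using pos q by (subst ln_mult_pos) (auto simp: ln_realpow intro: add_pos_nonneg)
  also have "ln (1 + r ^ 4 / dist x w ^ 4) \<le> r ^ 4 / dist x w ^ 4"
    using q by (rule ln_add_one_self_le_self)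
  finally show ?thesis by simp
qed

context energy_minimizer
begin

text \<open>
The support of the minimiser.
\<close>

abbreviation "T \<equiv> measure_supp \<mu>"

lemma closed_T: "closed T" by (rule closed_measure_supp)
lemma T_subset: "T \<subseteq> K" using on_K closed_K by (rule measure_supp_subset)
lemma AE_T: "AE w in \<mu>. w \<in> T"
  by (rule AE_I[of _ _ "- T"]) (use emeasure_compl_measure_supp[OF sets_\<mu>] closed_T in auto)

lemma AE_neq: "AE w in \<mu>. w \<noteq> z"
  by (rule AE_I[of _ _ "{z}"]) (auto simp: no_atoms)

lemma prob_UNIV: "prob UNIV = 1" using prob_space by simp

lemma T_nonempty: "T \<noteq> {}"
proof
  assume "T = {}"
  with AE_T have "AE w in \<mu>. False" by simp
  then show False by (simp add: AE_False)
qed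

text \<open>
The shifted minimal energy as a real number; \<open>exp (C - energy)\<close> is the capacity.
\<close>

definition energy :: real where "energy = enn2real (log_en C \<mu>)"

lemma log_en_eq: "log_en C \<mu> = ennreal energy"
  using finite by (simp add: energy_def less_top)

lemma energy_nonneg: "energy \<ge> 0" by (simp add: energy_def)

text \<open>
The shifted potential as a real-valued function, without truncation of the kernel, and hence
meaningful on the whole plane.
\<close>

definition \<phi> :: "complex \<Rightarrow> real" where "\<phi> z = (\<integral>w. C - ln (dist z w) \<partial>\<mu>)"

lemma dist_le_exp: "z \<in> cball 0 R \<Longrightarrow> w \<in> cball 0 R \<Longrightarrow> dist z w \<le> exp C"
  using dist_triangle[of z w 0] radius by (simp add: dist_commute)

lemma ln_dist_le: "z \<in> cball 0 R \<Longrightarrow> w \<in> cball 0 R \<Longrightarrow> z \<noteq> w \<Longrightarrow> ln (dist z w) \<le> C"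
  using dist_le_exp[of z w] by (metis exp_gt_zero ln_exp ln_le_cancel_iff zero_less_dist_iff)

lemma integrable_ln_dist_supp:
  assumes "z \<in> T"
  shows "integrable \<mu> (\<lambda>w. C - ln (dist z w))" "\<phi> z \<le> energy"
proof -
  have AE: "AE w in \<mu>. 0 \<le> C - ln (dist z w) \<and> log_kernel C z w = ennreal (C - ln (dist z w))"
    using AE_T AE_neq[of z]
  proof eventually_elim
    case (elim w)
    then have "z \<in> cball 0 R" "w \<in> cball 0 R" using T_subset K_cball assms by blast+
    then show ?case using elim ln_dist_le[of z w] by (auto simp: log_kernel_def)
  qed
  have "(\<integral>\<^sup>+w. ennreal (C - ln (dist z w)) \<partial>\<mu>) = log_pot C \<mu> z"
    unfolding log_pot_def using AE by (intro nn_integral_cong_AE) (force elim: eventually_mono)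
  also have "\<dots> \<le> ennreal energy" using log_pot_le_supp[OF assms] by (simp add: log_en_eq)
  finally have le: "(\<integral>\<^sup>+w. ennreal (C - ln (dist z w)) \<partial>\<mu>) \<le> ennreal energy" .
  then show int: "integrable \<mu> (\<lambda>w. C - ln (dist z w))"
    using AE by (intro integrableI_nonneg) (auto elim!: eventually_mono intro: le_less_trans)
  have "ennreal (\<phi> z) = (\<integral>\<^sup>+w. ennreal (C - ln (dist z w)) \<partial>\<mu>)"
    unfolding \<phi>_def using AE by (intro nn_integral_eq_integral[symmetric] int) (auto elim!: eventually_mono)
  then have "ennreal (\<phi> z) \<le> ennreal energy" using le by simp
  then show "\<phi> z \<le> energy" using ennreal_le_iff[OF energy_nonneg] by blast
qed

lemma integrable_ln_dist_off_supp:
  assumes "z \<notin> T"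
  shows "integrable \<mu> (\<lambda>w. C - ln (dist z w))"
proof -
  define d where "d = infdist z T"
  have d: "d > 0" unfolding d_def using assms closed_T T_nonempty by (simp add: infdist_pos_not_in_closed)
  have "integrable \<mu> (\<lambda>w. ln (dist z w))"
  proof (rule integrable_const_bound)
    show "AE w in \<mu>. norm (ln (dist z w)) \<le> \<bar>ln d\<bar> + \<bar>ln (cmod z + R)\<bar>"
      using AE_T
    proof eventually_elim
      case (elim w)
      have "d \<le> dist z w" unfolding d_def using elim by (rule infdist_le)
      moreover have "dist z w \<le> cmod z + R"
        using norm_triangle_ineq4[of z w] T_subset K_cball elim by (force simp: dist_norm)
      ultimately have "ln d \<le> ln (dist z w)" "ln (dist z w) \<le> ln (cmod z + R)"
        using d by (auto intro!: ln_mono)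
      then show ?case by auto
    qed
  qed measurable
  then show ?thesis by auto
qed

lemma integrable_ln_dist: "integrable \<mu> (\<lambda>w. C - ln (dist z w))"
  using integrable_ln_dist_supp integrable_ln_dist_off_supp by blast

lemma nearest_point:
  obtains y where "y \<in> T" "\<And>w. w \<in> T \<Longrightarrow> dist y w \<le> 2 * dist x w" "\<And>w. w \<in> T \<Longrightarrow> dist x y \<le> dist x w"
proof -
  obtain y where y: "y \<in> T" "infdist x T = dist x y"
    using infdist_attains_inf[OF closed_T T_nonempty] by blast
  have le: "dist x y \<le> dist x w" if "w \<in> T" for w using infdist_le[OF that, of x] y by simp
  have "dist y w \<le> 2 * dist x w" if "w \<in> T" for w
    using dist_triangle3[of y w x] le[OF that] by linarith
  with y le show thesis using that by blast
qed

text \<open>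
Comparison of the kernels at \<open>x\<close> and at a nearest point \<open>y\<close> of the
support: moving to \<open>y\<close> at most doubles the distance to any point of the support.
\<close>

lemma \<phi>_le_nearest:
  assumes "x \<notin> T" "y \<in> T" "\<And>w. w \<in> T \<Longrightarrow> dist y w \<le> 2 * dist x w"
  shows "AE w in \<mu>. 0 \<le> ln 2 + (C - ln (dist y w)) - (C - ln (dist x w))"
  using AE_T AE_neq[of y]
proof eventually_elim
  case (elim w)
  have p: "dist y w > 0" "dist x w > 0" using elim assms by auto
  then have "ln (dist y w) \<le> ln (2 * dist x w)" using assms(3)[OF elim(1)] by (intro ln_mono) auto
  also have "\<dots> = ln 2 + ln (dist x w)" using p by (simp add: ln_mult_pos)
  finally show ?case by simp
qed

lemma \<phi>_bounded:
  assumes "x \<notin> T"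
  shows "\<phi> x \<le> energy + ln 2"
proof -
  obtain y where y: "y \<in> T" "\<And>w. w \<in> T \<Longrightarrow> dist y w \<le> 2 * dist x w"
    using nearest_point by metis
  have "0 \<le> (\<integral>w. ln 2 + (C - ln (dist y w)) - (C - ln (dist x w)) \<partial>\<mu>)"
    using \<phi>_le_nearest[OF assms y] by (rule integral_nonneg_AE)
  also have "\<dots> = ln 2 + \<phi> y - \<phi> x"
    using integrable_ln_dist unfolding \<phi>_def
    by (subst Bochner_Integration.integral_diff, simp, simp)
       (subst Bochner_Integration.integral_add, simp_all add: prob_UNIV)
  finally show ?thesis using integrable_ln_dist_supp(2)[OF y(1)] by simp
qed

lemma \<phi>_far:
  assumes "cmod z \<ge> R + exp C"
  shows "\<phi> z \<le> 0"
proof -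
  have "AE w in \<mu>. C - ln (dist z w) \<le> 0"
    using AE_T
  proof eventually_elim
    case (elim w)
    have "exp C \<le> dist z w"
      using norm_triangle_ineq2[of z w] elim T_subset K_cball assms by (force simp: dist_norm)
    then have "ln (exp C) \<le> ln (dist z w)" by (intro ln_mono) (auto intro: less_le_trans[OF exp_gt_zero])
    then show ?case by simp
  qed
  then have "(\<integral>w. C - ln (dist z w) \<partial>\<mu>) \<le> (\<integral>w. 0 \<partial>\<mu>)"
    by (intro integral_mono_AE integrable_ln_dist) auto
  then show ?thesis by (simp add: \<phi>_def)
qed

lemma \<phi>_square:
  assumes "0 < r" "r < d" "\<And>w. w \<in> T \<Longrightarrow> d \<le> dist x w"
  shows "4 * \<phi> x - r^4 / d^4 \<le> \<phi> (x + of_real r) + \<phi> (x - of_real r) + \<phi> (x + \<i> * of_real r) + \<phi> (x - \<i> * of_real r)"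
proof -
  let ?f = "\<lambda>z w. C - ln (dist z w)"
  have "(\<integral>w. 4 * ?f x w - r^4 / d^4 \<partial>\<mu>)
     \<le> (\<integral>w. ?f (x + of_real r) w + ?f (x - of_real r) w + ?f (x + \<i> * of_real r) w + ?f (x - \<i> * of_real r) w \<partial>\<mu>)"
  proof (rule integral_mono_AE)
    show "AE w in \<mu>. 4 * ?f x w - r^4 / d^4 \<le> ?f (x + of_real r) w + ?f (x - of_real r) w + ?f (x + \<i> * of_real r) w + ?f (x - \<i> * of_real r) w"
      using AE_T
    proof eventually_elim
      case (elim w)
      have "r^4 / dist x w ^ 4 \<le> r^4 / d^4"
        using assms(1,2) assms(3)[OF elim] by (intro divide_left_mono power_mono mult_pos_pos) auto
      with sum_ln_dist_square[of r x w] assms(1,2) assms(3)[OF elim] show ?case by (simp add: algebra_simps)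
    qed
  qed (intro Bochner_Integration.integrable_add Bochner_Integration.integrable_diff integrable_mult_right integrable_ln_dist integrable_const)+
  moreover have hb: "has_bochner_integral \<mu> (?f z) (\<phi> z)" for z
    unfolding \<phi>_def using integrable_ln_dist by (rule has_bochner_integral_integrable)
  moreover have "(\<integral>w. 4 * ?f x w - r^4 / d^4 \<partial>\<mu>) = 4 * \<phi> x - r^4 / d^4"
    using has_bochner_integral_diff[OF has_bochner_integral_mult_right[OF hb[of x], of 4]
        has_bochner_integral_integrable[OF integrable_const[of "r^4 / d^4"]]]
    by (simp add: has_bochner_integral_iff prob_UNIV)
  moreover have "(\<integral>w. ?f (x + of_real r) w + ?f (x - of_real r) w + ?f (x + \<i> * of_real r) w + ?f (x - \<i> * of_real r) w \<partial>\<mu>)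
      = \<phi> (x + of_real r) + \<phi> (x - of_real r) + \<phi> (x + \<i> * of_real r) + \<phi> (x - \<i> * of_real r)"
    by (intro has_bochner_integral_integral_eq has_bochner_integral_add hb)
  ultimately show ?thesis by simp
qed

text \<open>
At the support the limit superior of the potential from outside is at most the energy. For nearest
points \<open>y\<^sub>n\<close> of \<open>x\<^sub>n\<close> the functions \<open>ln (2 |x\<^sub>n -
w| / |y\<^sub>n - w|)\<close> are non-negative and tend to \<open>ln 2\<close> off the limit point,
so Fatou's lemma compares \<open>\<phi> x\<^sub>n\<close> with \<open>\<phi> y\<^sub>n\<close>
without any continuity of the potential on the support.
\<close>

lemma \<phi>_boundary:
  assumes "x \<longlonglongrightarrow> z" "z \<in> T" "\<And>n. x n \<notin> T" "\<eta> > 0"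
  shows "\<not> (eventually (\<lambda>n. \<phi> (x n) \<ge> energy + \<eta>) sequentially)"
proof
  assume ev: "eventually (\<lambda>n. \<phi> (x n) \<ge> energy + \<eta>) sequentially"
  have "\<exists>y. \<forall>n. y n \<in> T \<and> (\<forall>w\<in>T. dist (y n) w \<le> 2 * dist (x n) w \<and> dist (x n) (y n) \<le> dist (x n) w)"
    by (intro choice allI) (metis nearest_point)
  then obtain y where y: "\<And>n. y n \<in> T" "\<And>n w. w \<in> T \<Longrightarrow> dist (y n) w \<le> 2 * dist (x n) w"
    "\<And>n w. w \<in> T \<Longrightarrow> dist (x n) (y n) \<le> dist (x n) w" by blast
  have "(\<lambda>n. dist (x n) z) \<longlonglongrightarrow> 0" using assms(1) by (rule iffD1[OF tendsto_dist_iff])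
  then have lim0: "(\<lambda>n. 2 * dist (x n) z) \<longlonglongrightarrow> 0" by (rule tendsto_mult_right_zero)
  have yx: "dist (y n) z \<le> 2 * dist (x n) z" for n using y(2) assms(2) by blast
  have "(\<lambda>n. dist (y n) z) \<longlonglongrightarrow> 0"
    by (rule metric_tendsto_imp_tendsto[OF lim0 always_eventually]) (use yx in auto)
  then have yz: "y \<longlonglongrightarrow> z" by (rule iffD2[OF tendsto_dist_iff])
  define g where "g n w = ln 2 + (C - ln (dist (y n) w)) - (C - ln (dist (x n) w))" for n w
  have g_int: "integrable \<mu> (g n)" for n
    unfolding g_def by (intro Bochner_Integration.integrable_add Bochner_Integration.integrable_diff integrable_ln_dist integrable_const)
  have g_nonneg: "AE w in \<mu>. 0 \<le> g n w" for n
    unfolding g_def using assms(3) y(1,2) by (rule \<phi>_le_nearest)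
  have g_integral: "(\<integral>w. g n w \<partial>\<mu>) = ln 2 + \<phi> (y n) - \<phi> (x n)" for n
    using integrable_ln_dist unfolding \<phi>_def g_def
    by (subst Bochner_Integration.integral_diff, simp, simp)
       (subst Bochner_Integration.integral_add, simp_all add: prob_UNIV)
  have lim: "AE w in \<mu>. liminf (\<lambda>n. ennreal (g n w)) = ennreal (ln 2)"
    using AE_neq[of z]
  proof eventually_elim
    case (elim w)
    have "(\<lambda>n. g n w) \<longlonglongrightarrow> ln 2 + (C - ln (dist z w)) - (C - ln (dist z w))"
      unfolding g_def using elim by (intro tendsto_intros yz assms(1)) auto
    then have "(\<lambda>n. ennreal (g n w)) \<longlonglongrightarrow> ennreal (ln 2)"
      by (intro tendsto_ennrealI) simp
    then show ?case by (intro lim_imp_Liminf) auto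
  qed
  have "ennreal (ln 2) = (\<integral>\<^sup>+w. ennreal (ln 2) \<partial>\<mu>)" using emeasure_space_1 by simp
  also have "\<dots> = (\<integral>\<^sup>+w. liminf (\<lambda>n. ennreal (g n w)) \<partial>\<mu>)"
    using lim by (intro nn_integral_cong_AE) (auto elim!: eventually_mono)
  also have "\<dots> \<le> liminf (\<lambda>n. \<integral>\<^sup>+w. ennreal (g n w) \<partial>\<mu>)"
    by (rule nn_integral_liminf) (use g_int in auto)
  also have "\<dots> \<le> liminf (\<lambda>n. ennreal (ln 2 - \<eta>))"
  proof (rule Liminf_mono)
    show "\<forall>\<^sub>F n in sequentially. (\<integral>\<^sup>+w. ennreal (g n w) \<partial>\<mu>) \<le> ennreal (ln 2 - \<eta>)"
      using ev
    proof eventually_elim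
      case (elim n)
      have "(\<integral>\<^sup>+w. ennreal (g n w) \<partial>\<mu>) = ennreal (ln 2 + \<phi> (y n) - \<phi> (x n))"
        by (simp add: nn_integral_eq_integral[OF g_int g_nonneg] g_integral)
      also have "\<dots> \<le> ennreal (ln 2 - \<eta>)"
        using elim integrable_ln_dist_supp(2)[OF y(1)[of n]] by (intro ennreal_leI) simp
      finally show ?case .
    qed
  qed
  also have "\<dots> = ennreal (ln 2 - \<eta>)" by (simp add: Liminf_const)
  finally show False using assms(4) by (simp add: ennreal_le_iff2)
qed

text \<open>
The maximum principle. If \<open>\<phi> z\<close> exceeded the energy by \<open>3 \<eta>\<close>,
take a maximising sequence off the support for \<open>\<phi> + \<delta> |x|\<^sup>2\<close> in a
large ball, with \<open>\<delta>\<close> so small that the quadratic term is at most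
\<open>\<eta>\<close>. Its limit cannot lie in the support, by the previous lemma. Elsewhere the
quadratic term gains \<open>\<delta> q\<^sup>2\<close> in the mean over a square of radius
\<open>q\<close>, while \<open>\<phi>\<close> loses only a fourth-order amount.
\<close>

theorem \<phi>_le_energy: "\<phi> z \<le> energy"
proof (cases "z \<in> T")
  case True
  then show ?thesis by (rule integrable_ln_dist_supp)
next
  case zT: False
  show ?thesis
  proof (rule ccontr)
    assume neg: "\<not> \<phi> z \<le> energy"
    define \<eta> where "\<eta> = (\<phi> z - energy) / 3"
    have \<eta>: "\<eta> > 0" "\<phi> z = energy + 3 * \<eta>" using neg by (auto simp: \<eta>_def field_simps)
    \<comment> \<open>Beyond \<open>R1\<close> the potential is at most \<open>0\<close>, so squares about the maximising points stay in the ball of radius \<open>R0\<close>.\<close>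
    define R1 where "R1 = \<bar>R\<bar> + exp C"
    define R0 where "R0 = R1 + 1 + cmod z"
    have R1: "R1 > 0" by (simp add: R1_def add_nonneg_pos)
    have R0: "R0 > 0" "cmod z \<le> R0" "R1 + 1 \<le> R0" using R1 norm_ge_zero[of z] unfolding R0_def by linarith+
    have far: "\<phi> x \<le> 0" if "cmod x \<ge> R1" for x
      using that by (intro \<phi>_far) (auto simp: R1_def)
    define \<delta> where "\<delta> = \<eta> / R0^2"
    have \<delta>: "\<delta> > 0" using \<eta> R0 by (simp add: \<delta>_def)
    define \<psi> where "\<psi> x = \<phi> x + \<delta> * (cmod x)^2" for x
    define A where "A = cball 0 R0 - T"
    have zA: "z \<in> A" using zT R0 by (simp add: A_def)
    have small: "\<delta> * (cmod x)^2 \<le> \<eta>" if "x \<in> A" for x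
    proof -
      have "(cmod x)^2 \<le> R0^2" using that by (intro power_mono) (auto simp: A_def)
      then show ?thesis using \<eta> R0 by (simp add: \<delta>_def field_simps)
    qed
    have bdd: "bdd_above (\<psi> ` A)"
      using small \<phi>_bounded by (intro bdd_aboveI2[of _ _ "energy + ln 2 + \<eta>"]) (force simp: \<psi>_def A_def intro: add_mono)
    define s where "s = Sup (\<psi> ` A)"
    have s_upper: "\<psi> x \<le> s" if "x \<in> A" for x
      unfolding s_def using that bdd by (intro cSup_upper) auto
    have s_lower: "energy + 3 * \<eta> \<le> s"
      using s_upper[OF zA] \<delta> \<eta> by (auto simp: \<psi>_def intro: order_trans[rotated])
    have "\<exists>x\<in>A. s - inverse (real (Suc n)) < \<psi> x" for n
    proof -
      have "s - inverse (real (Suc n)) < Sup (\<psi> ` A)" by (simp add: s_def del: of_nat_Suc)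
      then show ?thesis using zA by (subst (asm) less_cSup_iff[OF _ bdd]) auto
    qed
    then obtain x where x: "\<And>n. x n \<in> A" "\<And>n. s - inverse (real (Suc n)) < \<psi> (x n)" by metis
    have "\<exists>l r. strict_mono r \<and> ((x \<circ> r) \<longlongrightarrow> l) sequentially"
      using compact_cball[of "0::complex" R0] x(1) unfolding compact_def A_def by blast
    then obtain l r where r: "strict_mono r" "(x \<circ> r) \<longlonglongrightarrow> l" by blast
    define y where "y = x \<circ> r"
    have yA: "y n \<in> A" for n using x by (simp add: y_def)
    have y_lower: "s - inverse (real (Suc n)) < \<psi> (y n)" for n
    proof -
      have "inverse (real (Suc (r n))) \<le> inverse (real (Suc n))"
        using seq_suble[OF r(1), of n] by (intro le_imp_inverse_le) auto
      then show ?thesis using x(2)[of "r n"] unfolding y_def comp_def by linarith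
    qed
    have inv0: "(\<lambda>n. inverse (real (Suc n))) \<longlonglongrightarrow> 0" by (rule LIMSEQ_inverse_real_of_nat)
    have ev: "eventually (\<lambda>n. \<phi> (y n) \<ge> energy + \<eta>) sequentially"
      using order_tendstoD(2)[OF inv0 \<eta>(1)]
    proof eventually_elim
      case (elim n)
      then show ?case using y_lower[of n] small[OF yA[of n]] s_lower by (simp add: \<psi>_def)
    qed
    show False
    proof (cases "l \<in> T")
      case True
      then show False using \<phi>_boundary[OF r(2)[folded y_def] True _ \<eta>(1)] ev yA by (auto simp: A_def)
    next
      case False
      define d where "d = infdist l T / 2"
      have d: "d > 0" unfolding d_def using False closed_T T_nonempty by (simp add: infdist_pos_not_in_closed)
      \<comment> \<open>The last bound gives \<open>q\<^sup>4 / d\<^sup>4 \<le> 2 * \<delta> * q\<^sup>2\<close>, half of the gain of the quadratic term in the sum over the square.\<close>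
      define q where "q = min (min 1 (d / 2)) (sqrt (2 * \<delta>) * d^2)"
      have q: "0 < q" "q \<le> 1" "q < d" "q \<le> sqrt (2 * \<delta>) * d^2"
        using d \<delta> by (auto simp: q_def)
      have "q^2 \<le> (sqrt (2 * \<delta>) * d^2)^2" using q by (intro power_mono) auto
      also have "\<dots> = 2 * \<delta> * d^4" using \<delta> by (simp add: power_mult_distrib)
      finally have "q^2 * q^2 \<le> 2 * \<delta> * d^4 * q^2" by (rule mult_right_mono) simp
      then have q4: "q^4 / d^4 \<le> 2 * \<delta> * q^2" using d by (simp add: field_simps flip: power_add)
      have "0 < 2 * \<delta> * q^2 / 4" using \<delta> q by simp
      then have ev2: "\<forall>\<^sub>F n in sequentially. inverse (real (Suc n)) < 2 * \<delta> * q^2 / 4"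
        using order_tendstoD(2)[OF inv0] by blast
      have ev3: "\<forall>\<^sub>F n in sequentially. dist (y n) l < d"
        using tendstoD[OF r(2)[folded y_def] d] .
      have "\<forall>\<^sub>F n in sequentially. False"
        using ev ev2 ev3
        proof eventually_elim
          case (elim n)
          have dT: "d \<le> dist (y n) w" if "w \<in> T" for w
            using infdist_le[OF that, of l] dist_triangle3[of l w "y n"] elim(3) by (simp add: d_def dist_commute)
          have "cmod (y n) < R1"
            using far[of "y n"] elim(1) energy_nonneg \<eta> by (cases "cmod (y n) < R1") auto
          then have inA: "y n + u \<in> A" if "cmod u = q" for u
          proof -
            have "cmod (y n + u) \<le> R0" using norm_triangle_ineq[of "y n" u] that q R0 \<open>cmod (y n) < R1\<close> by linarith
            moreover have "y n + u \<notin> T"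
              using dT[of "y n + u"] that q by (auto simp: dist_norm)
            ultimately show ?thesis by (simp add: A_def)
          qed
          have sq: "(cmod (y n + of_real q))^2 + (cmod (y n - of_real q))^2 + (cmod (y n + \<i> * of_real q))^2 + (cmod (y n - \<i> * of_real q))^2
            = 4 * (cmod (y n))^2 + 4 * q^2"
            unfolding cmod_power2 by (simp add: power2_eq_square algebra_simps)
          have "4 * \<psi> (y n) + 4 * \<delta> * q^2 - q^4 / d^4 \<le> (\<phi> (y n + of_real q) + \<phi> (y n - of_real q) + \<phi> (y n + \<i> * of_real q) + \<phi> (y n - \<i> * of_real q))
               + \<delta> * (4 * (cmod (y n))^2 + 4 * q^2)"
            using \<phi>_square[OF q(1,3) dT] by (simp add: \<psi>_def algebra_simps)
          also have "\<dots> = \<psi> (y n + of_real q) + \<psi> (y n + - of_real q) + \<psi> (y n + \<i> * of_real q) + \<psi> (y n + - (\<i> * of_real q))"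
            unfolding sq[symmetric] by (simp add: \<psi>_def algebra_simps)
          also have "\<dots> \<le> s + s + s + s"
            using q by (intro add_mono s_upper inA) (auto simp: norm_mult)
          finally have "4 * \<psi> (y n) + 2 * \<delta> * q^2 \<le> 4 * s" using q4 by simp
          then show False using y_lower[of n] elim(2) by simp
        qed
      then show False by simp
    qed
  qed
qed

lemma integrable_ln_dist': "integrable \<mu> (\<lambda>w. ln (dist z w))"
  using Bochner_Integration.integrable_diff[OF integrable_const[of C] integrable_ln_dist[of z]] by simp

text \<open>
In terms of logarithms: \<open>\<integral> log |z - w| d\<mu>(w)\<close> is at least the logarithm
of the capacity, for every \<open>z\<close>.
\<close>

lemma integral_ln_dist_ge: "C - energy \<le> (\<integral>w. ln (dist z w) \<partial>\<mu>)"
proof -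
  have "\<phi> z = C - (\<integral>w. ln (dist z w) \<partial>\<mu>)"
    unfolding \<phi>_def using integrable_ln_dist' by (simp add: prob_UNIV)
  then show ?thesis using \<phi>_le_energy[of z] by simp
qed

end

section \<open>Circle means of the logarithmic kernel\<close>

text \<open>
The uniform distribution on \<open>[0, 1]\<close>, parametrising a circle by \<open>\<theta>
\<mapsto> cis (2 * pi * \<theta>)\<close>.
\<close>

definition circle_param :: "real measure"
  where "circle_param = uniform_measure lborel {0..1}"

lemma sets_circle_param [simp, measurable_cong]: "sets circle_param = sets borel"
  by (simp add: circle_param_def)

lemma space_circle_param [simp]: "space circle_param = UNIV"
  by (simp add: circle_param_def)

interpretation circle_param: prob_space circle_param
  unfolding circle_param_def by (rule prob_space_uniform_measure) auto

lemma nn_integral_circle_param: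
  assumes [measurable]: "f \<in> borel_measurable borel"
    and "\<And>x. 0 \<le> f x" "(f has_integral I) {0..1}"
  shows "(\<integral>\<^sup>+\<theta>. ennreal (f \<theta>) \<partial>circle_param) = ennreal I"
proof -
  have "(\<integral>\<^sup>+\<theta>. ennreal (f \<theta>) \<partial>circle_param) = (\<integral>\<^sup>+\<theta>. ennreal (f \<theta>) * indicator {0..1} \<theta> \<partial>lborel)"
    unfolding circle_param_def by (subst nn_integral_uniform_measure) (auto simp: divide_ennreal_def)
  also have "\<dots> = (\<integral>\<^sup>+\<theta>. ennreal (indicator {0..1} \<theta> * f \<theta>) \<partial>lborel)"
    by (intro nn_integral_cong) (auto simp: indicator_def)
  also have "\<dots> = ennreal I"
  proof (rule nn_integral_has_integral_lborel)
    have "((\<lambda>\<theta>. if \<theta> \<in> {0..1} then f \<theta> else 0) has_integral I) UNIV"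
      using assms(3) by (simp only: has_integral_restrict_UNIV)
    then show "((\<lambda>\<theta>. indicator {0..1} \<theta> * f \<theta>) has_integral I) UNIV"
      by (rule has_integral_eq[rotated]) (simp add: indicator_def)
  qed (use assms(2) in auto)
  finally show ?thesis .
qed

lemma cis_measurable [measurable]: "cis \<in> borel_measurable borel"
  by (intro borel_measurable_continuous_onI continuous_on_cis continuous_on_id)

text \<open>
For \<open>|b| < 1\<close> the function \<open>Ln (1 - b u)\<close> is holomorphic on the closed
disc and vanishes at \<open>0\<close>, so the mean of \<open>ln |1 - b u|\<close> over the unit
circle is \<open>0\<close>. The shift \<open>ln 2\<close> makes the kernel non-negative, since
\<open>|1 - b u| \<le> 2\<close>.
\<close>

lemma circle_mean_kernel_inside:
  assumes "cmod b < 1"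
  shows "(\<integral>\<^sup>+\<theta>. log_kernel (ln 2) 1 (b * cis (2 * pi * \<theta>)) \<partial>circle_param) = ennreal (ln 2)"
proof -
  have small: "cmod (b * u) < 1" if "cmod u \<le> 1" for u
  proof -
    have "cmod b * cmod u \<le> cmod b * 1" using that by (intro mult_left_mono) auto
    then show ?thesis using assms by (simp add: norm_mult)
  qed
  have re_pos: "0 < Re (1 - b * u)" if "cmod u \<le> 1" for u
    using small[OF that] complex_Re_le_cmod[of "b * u"] by simp
  define f where "f u = Ln (1 - b * u)" for u
  have "f holomorphic_on cball 0 1"
    unfolding f_def
  proof (intro holomorphic_intros)
    fix u :: complex assume "u \<in> cball 0 1"
    then show "1 - b * u \<notin> \<real>\<^sub>\<le>\<^sub>0" using re_pos[of u] by (auto simp: complex_nonpos_Reals_iff)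
  qed
  then have "((\<lambda>u. f u / (u - 0)) has_contour_integral (2 * of_real pi * \<i> * f 0)) (circlepath 0 1)"
    by (rule Cauchy_integral_circlepath_simple) simp
  then have "((\<lambda>x. f (circlepath 0 1 x) / circlepath 0 1 x * vector_derivative (circlepath 0 1) (at x within {0..1}))
      has_integral 0) {0..1}"
    by (simp add: has_contour_integral_def f_def)
  then have "((\<lambda>x. (2 * of_real pi * \<i>) * f (cis (2 * pi * x))) has_integral 0) {0..1}"
  proof (rule has_integral_eq[rotated])
    fix x :: real assume x: "x \<in> {0..1}"
    have "circlepath 0 1 x = cis (2 * pi * x)" by (simp add: circlepath cis_conv_exp mult_ac)
    moreover have "vector_derivative (circlepath 0 1) (at x within {0..1}) = 2 * of_real pi * \<i> * cis (2 * pi * x)"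
      using x by (simp add: vector_derivative_circlepath01 cis_conv_exp mult_ac)
    ultimately show "f (circlepath 0 1 x) / circlepath 0 1 x * vector_derivative (circlepath 0 1) (at x within {0..1})
      = 2 * of_real pi * \<i> * f (cis (2 * pi * x))" by simp
  qed
  then have "((\<lambda>x. inverse (2 * of_real pi * \<i>) * ((2 * of_real pi * \<i>) * f (cis (2 * pi * x)))) has_integral inverse (2 * of_real pi * \<i>) * 0) {0..1}"
    by (rule has_integral_mult_right)
  then have "((\<lambda>x. f (cis (2 * pi * x))) has_integral 0) {0..1}"
    by (simp add: field_simps)
  from has_integral_linear[OF this bounded_linear_Re]
  have int: "((\<lambda>x. Re (f (cis (2 * pi * x)))) has_integral 0) {0..1}" by (simp add: o_def)
  have ne: "1 - b * u \<noteq> 0" if "cmod u \<le> 1" for u using re_pos[OF that] zero_complex.sel(1) by (metis less_irrefl)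
  have Ref: "Re (f (cis (2 * pi * x))) = ln (dist 1 (b * cis (2 * pi * x)))" for x
    using ne[of "cis (2 * pi * x)"] by (simp add: f_def dist_norm Re_Ln)
  have "((\<lambda>x. ln 2 - ln (dist 1 (b * cis (2 * pi * x)))) has_integral (1 * ln 2 - 0)) {0..1}"
    using has_integral_diff[OF has_integral_const_real[of "ln 2" 0 1] int] by (simp add: Ref)
  moreover have "0 \<le> ln 2 - ln (dist 1 (b * cis (2 * pi * x)))" for x
  proof -
    have "dist 1 (b * cis (2 * pi * x)) \<le> 2"
      using norm_triangle_ineq4[of 1 "b * cis (2 * pi * x)"] small[of "cis (2 * pi * x)"] by (simp add: dist_norm)
    moreover have "dist 1 (b * cis (2 * pi * x)) > 0" using ne[of "cis (2 * pi * x)"] by simp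
    ultimately show ?thesis by simp
  qed
  ultimately have "(\<integral>\<^sup>+\<theta>. ennreal (ln 2 - ln (dist 1 (b * cis (2 * pi * \<theta>)))) \<partial>circle_param) = ennreal (ln 2)"
    by (subst nn_integral_circle_param) auto
  moreover have "log_kernel (ln 2) 1 (b * cis (2 * pi * \<theta>)) = ennreal (ln 2 - ln (dist 1 (b * cis (2 * pi * \<theta>))))" for \<theta>
    using ne[of "cis (2 * pi * \<theta>)"] by (auto simp: log_kernel_def)
  ultimately show ?thesis by simp
qed

text \<open>
The boundary case \<open>|b| = 1\<close> follows from Fatou's lemma, which gives the inequality in
the direction needed.
\<close>

lemma circle_mean_kernel_unit:
  assumes "cmod b \<le> 1"
  shows "(\<integral>\<^sup>+\<theta>. log_kernel (ln 2) 1 (b * cis (2 * pi * \<theta>)) \<partial>circle_param) \<le> ennreal (ln 2)"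
proof -
  define c where "c n = of_real (1 - inverse (real (Suc n))) * b" for n
  have c: "cmod (c n) < 1" for n
  proof -
    have "\<bar>1 - inverse (real (Suc n))\<bar> < 1" by (simp add: abs_if field_simps)
    moreover have "cmod (c n) = \<bar>1 - inverse (real (Suc n))\<bar> * cmod b"
      unfolding c_def norm_mult norm_of_real ..
    moreover have "\<bar>1 - inverse (real (Suc n))\<bar> * cmod b \<le> \<bar>1 - inverse (real (Suc n))\<bar> * 1"
      using assms by (intro mult_left_mono) auto
    ultimately show ?thesis by simp
  qed
  have "c \<longlonglongrightarrow> of_real (1 - 0) * b"
    unfolding c_def by (intro tendsto_intros LIMSEQ_inverse_real_of_nat)
  then have "c \<longlonglongrightarrow> b" by simp
  then have "(\<integral>\<^sup>+\<theta>. log_kernel (ln 2) 1 (b * cis (2 * pi * \<theta>)) \<partial>circle_param)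
      = (\<integral>\<^sup>+\<theta>. liminf (\<lambda>n. log_kernel (ln 2) 1 (c n * cis (2 * pi * \<theta>))) \<partial>circle_param)"
    by (intro nn_integral_cong lim_imp_Liminf[symmetric] tendsto_log_kernel tendsto_intros) auto
  also have "\<dots> \<le> liminf (\<lambda>n. \<integral>\<^sup>+\<theta>. log_kernel (ln 2) 1 (c n * cis (2 * pi * \<theta>)) \<partial>circle_param)"
    by (rule nn_integral_liminf) measurable
  also have "\<dots> = ennreal (ln 2)" by (simp add: circle_mean_kernel_inside[OF c] Liminf_const)
  finally show ?thesis .
qed

text \<open>
The mean of \<open>- ln |w - \<cdot>|\<close> over a circle of radius \<open>r\<close> about
\<open>z\<close> is at most \<open>- ln (max |w - z| r)\<close>; in particular the kernel is
superharmonic, strictly so when \<open>w\<close> lies inside the circle. The second assumption keeps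
the kernel untruncated on the circle, whose points are at distance at most \<open>|w - z| +
r\<close> from \<open>w\<close>.
\<close>

lemma circle_mean_kernel:
  assumes "0 < r" "2 * max (dist w z) r \<le> exp C"
  shows "(\<integral>\<^sup>+\<theta>. log_kernel C w (z + of_real r * cis (2 * pi * \<theta>)) \<partial>circle_param)
     \<le> ennreal (C - ln (max (dist w z) r))"
proof -
  define m where "m = max (dist w z) r"
  have m: "m > 0" using assms(1) by (simp add: m_def)
  \<comment> \<open>Dividing by the larger of \<open>|w - z|\<close> and \<open>r\<close> reduces both cases to the unit circle; when \<open>r\<close> is larger, conjugation restores the form \<open>1 - b u\<close>.\<close>
  obtain b where b: "cmod b \<le> 1"
    and dist: "\<And>\<theta>. dist w (z + of_real r * cis \<theta>) = m * dist 1 (b * cis \<theta>)"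
  proof (cases "dist w z < r")
    case True
    then have mr: "m = r" by (simp add: m_def)
    show thesis
    proof (rule that[of "cnj (w - z) / of_real r"])
      show "cmod (cnj (w - z) / of_real r) \<le> 1"
        using True assms(1) by (simp only: norm_divide complex_mod_cnj) (simp add: dist_norm)
      fix \<theta>
      have "dist w (z + of_real r * cis \<theta>) = cmod (of_real r * cis \<theta> - (w - z))"
        by (simp add: dist_norm norm_minus_commute algebra_simps)
      also have "\<dots> = cmod (cnj (of_real r * cis \<theta> - (w - z)) * cis \<theta>)"
        by (simp only: norm_mult complex_mod_cnj norm_cis mult_1_right)
      also have "cnj (of_real r * cis \<theta> - (w - z)) * cis \<theta> = of_real r * (1 - cnj (w - z) / of_real r * cis \<theta>)"
      proof -
        have "cnj (cis \<theta>) * cis \<theta> = 1" by (simp add: cis_cnj cis_mult)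
        then have "cnj (of_real r * cis \<theta> - (w - z)) * cis \<theta> = of_real r - cnj (w - z) * cis \<theta>"
          by (simp add: left_diff_distrib mult.assoc)
        also have "\<dots> = of_real r * (1 - cnj (w - z) / of_real r * cis \<theta>)"
          using assms(1) by (simp add: right_diff_distrib del: complex_cnj_diff)
        finally show ?thesis .
      qed
      also have "cmod \<dots> = r * dist 1 (cnj (w - z) / of_real r * cis \<theta>)"
        using assms(1) by (simp add: norm_mult dist_norm del: complex_cnj_diff)
      finally show "dist w (z + of_real r * cis \<theta>) = m * dist 1 (cnj (w - z) / of_real r * cis \<theta>)" 
        by (simp add: mr)
    qed
  next
    case False
    then have md: "m = dist w z" and ne: "w - z \<noteq> 0" using assms(1) by (auto simp: m_def)
    show thesis
    proof (rule that[of "of_real r / (w - z)"])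
      show "cmod (of_real r / (w - z)) \<le> 1"
        using False assms(1) ne by (simp add: norm_divide dist_norm divide_le_eq)
      fix \<theta>
      have "w - (z + of_real r * cis \<theta>) = (w - z) * (1 - of_real r / (w - z) * cis \<theta>)"
        using ne by (simp add: right_diff_distrib)
      then show "dist w (z + of_real r * cis \<theta>) = m * dist 1 (of_real r / (w - z) * cis \<theta>)"
        by (simp add: md dist_norm norm_mult)
    qed
  qed
  have "ln (2 * m) \<le> ln (exp C)" using assms(2) m unfolding m_def by (intro ln_mono) auto
  then have C: "ln 2 \<le> C - ln m" using m by (simp add: ln_mult_pos)
  have kernel: "log_kernel C w (z + of_real r * cis \<theta>) = ennreal (C - ln m - ln 2) + log_kernel (ln 2) 1 (b * cis \<theta>)" for \<theta>
  proof (cases "dist 1 (b * cis \<theta>) = 0")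
    case True
    moreover from True have "dist w (z + of_real r * cis \<theta>) = 0" by (simp add: dist)
    ultimately show ?thesis by (simp add: log_kernel_def)
  next
    case False
    then have pos: "dist 1 (b * cis \<theta>) > 0" by simp
    then have ne: "dist w (z + of_real r * cis \<theta>) > 0" using m by (simp add: dist)
    have "dist 1 (b * cis \<theta>) \<le> 2"
      using norm_triangle_ineq4[of 1 "b * cis \<theta>"] b by (simp add: dist_norm norm_mult)
    then have "ln (dist 1 (b * cis \<theta>)) \<le> ln 2" using pos by simp
    then have "ennreal (C - ln m - ln 2) + ennreal (ln 2 - ln (dist 1 (b * cis \<theta>)))
        = ennreal (C - ln m - ln 2 + (ln 2 - ln (dist 1 (b * cis \<theta>))))"
      using C by (intro ennreal_plus[symmetric]) auto
    also have "C - ln m - ln 2 + (ln 2 - ln (dist 1 (b * cis \<theta>))) = C - ln (dist w (z + of_real r * cis \<theta>))"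
      using m pos by (simp add: dist ln_mult_pos)
    finally show ?thesis using pos ne by (auto simp: log_kernel_def)
  qed
  have "(\<integral>\<^sup>+\<theta>. log_kernel C w (z + of_real r * cis (2 * pi * \<theta>)) \<partial>circle_param)
      = ennreal (C - ln m - ln 2) + (\<integral>\<^sup>+\<theta>. log_kernel (ln 2) 1 (b * cis (2 * pi * \<theta>)) \<partial>circle_param)"
    unfolding kernel by (subst nn_integral_add) (auto simp: circle_param.emeasure_space_1[simplified])
  also have "\<dots> \<le> ennreal (C - ln m - ln 2) + ennreal (ln 2)"
    by (intro add_left_mono circle_mean_kernel_unit b)
  also have "\<dots> = ennreal (C - ln m)" using C by (subst ennreal_plus[symmetric]) auto
  finally show ?thesis by (simp add: m_def)
qed

lemma circle_mean_square:
  "(\<integral>\<^sup>+\<theta>. ennreal ((dist (z + of_real r * cis (2 * pi * \<theta>)) c)\<^sup>2) \<partial>circle_param)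
     = ennreal ((dist z c)\<^sup>2) + ennreal (r\<^sup>2)"
proof -
  define a where "a = z - c"
  define F where "F \<theta> = ((cmod a)\<^sup>2 + r\<^sup>2) * \<theta> + r * (Re a * sin (2 * pi * \<theta>) - Im a * cos (2 * pi * \<theta>)) / pi" for \<theta>
  have expand: "(dist (z + of_real r * cis (2 * pi * \<theta>)) c)\<^sup>2
      = (cmod a)\<^sup>2 + r\<^sup>2 + 2 * r * (Re a * cos (2 * pi * \<theta>) + Im a * sin (2 * pi * \<theta>))" for \<theta>
  proof -
    have "dist (z + of_real r * cis (2 * pi * \<theta>)) c = cmod (a + of_real r * cis (2 * pi * \<theta>))"
      by (simp add: dist_norm a_def algebra_simps)
    moreover have "(Re a + r * cos x)\<^sup>2 + (Im a + r * sin x)\<^sup>2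
      = (Re a)\<^sup>2 + (Im a)\<^sup>2 + r\<^sup>2 + 2 * r * (Re a * cos x + Im a * sin x)" for x
      using sin_cos_squared_add[of x] by algebra
    ultimately show ?thesis by (simp add: cmod_power2)
  qed
  have "((\<lambda>\<theta>. (dist (z + of_real r * cis (2 * pi * \<theta>)) c)\<^sup>2) has_integral (F 1 - F 0)) {0..1}"
  proof (rule fundamental_theorem_of_calculus)
    fix \<theta> :: real
    have "(F has_real_derivative (cmod a)\<^sup>2 + r\<^sup>2 + 2 * r * (Re a * cos (2 * pi * \<theta>) + Im a * sin (2 * pi * \<theta>))) (at \<theta> within {0..1})"
      unfolding F_def by (auto intro!: derivative_eq_intros simp: field_simps)
    then show "(F has_vector_derivative (dist (z + of_real r * cis (2 * pi * \<theta>)) c)\<^sup>2) (at \<theta> within {0..1})"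
      by (simp add: expand has_real_derivative_iff_has_vector_derivative)
  qed simp
  moreover have "F 1 - F 0 = (cmod a)\<^sup>2 + r\<^sup>2"
    by (simp add: F_def field_simps)
  ultimately show ?thesis
    by (subst nn_integral_circle_param) (auto simp: a_def dist_norm)
qed

section \<open>The walk on spheres\<close>

text \<open>
One step of the walk: a point of the circle about \<open>z\<close> whose radius is half the distance
to \<open>B\<close>. The factor one half keeps the walk off \<open>B\<close>.
\<close>

definition sphere_step :: "complex set \<Rightarrow> complex \<Rightarrow> real \<Rightarrow> complex"
  where "sphere_step B z \<theta> = z + of_real (infdist z B / 2) * cis (2 * pi * \<theta>)"

text \<open>
The walk after \<open>n\<close> steps from \<open>z\<close>, driven by a sequence of angles. The
recursion is on the first step, so that statements about all starting points can be proved by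
induction on \<open>n\<close> with the shift of the angle sequence.
\<close>

primrec sphere_walk :: "complex set \<Rightarrow> nat \<Rightarrow> complex \<Rightarrow> (nat \<Rightarrow> real) \<Rightarrow> complex"
  where "sphere_walk B 0 z \<omega> = z"
  | "sphere_walk B (Suc n) z \<omega> = sphere_walk B n (sphere_step B z (\<omega> 0)) (\<lambda>i. \<omega> (Suc i))"

interpretation circle_seq: sequence_space circle_param
  by unfold_locales

abbreviation "circle_seq \<equiv> PiM (UNIV :: nat set) (\<lambda>_. circle_param)"

lemma infdist_measurable [measurable]: "(\<lambda>z::complex. infdist z B) \<in> borel_measurable borel"
  by (intro borel_measurable_continuous_onI continuous_intros)

lemma sphere_step_measurable [measurable (raw)]:
  assumes [measurable]: "f \<in> borel_measurable M" "g \<in> borel_measurable M"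
  shows "(\<lambda>x. sphere_step B (f x) (g x)) \<in> borel_measurable M"
  unfolding sphere_step_def by measurable

lemma shift_measurable: "(\<lambda>\<omega> i. \<omega> (Suc i)) \<in> circle_seq \<rightarrow>\<^sub>M circle_seq"
  by (rule measurable_PiM_single') (auto simp: space_PiM)

lemma sphere_walk_measurable_pair:
  "(\<lambda>p. sphere_walk B n (fst p) (snd p)) \<in> borel_measurable (borel \<Otimes>\<^sub>M circle_seq)"
proof (induction n)
  case (Suc n)
  have [measurable]: "(\<lambda>\<omega>. \<omega> 0) \<in> borel_measurable circle_seq"
    using measurable_component_singleton[of 0 UNIV "\<lambda>_. circle_param"] by (simp cong: measurable_cong_sets)
  note [measurable] = shift_measurable
  have "(\<lambda>p. (sphere_step B (fst p) (snd p 0), \<lambda>i. snd p (Suc i))) \<in> borel \<Otimes>\<^sub>M circle_seq \<rightarrow>\<^sub>M borel \<Otimes>\<^sub>M circle_seq"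
    by measurable
  from measurable_compose[OF this Suc] show ?case by simp
qed simp

lemma sphere_walk_measurable [measurable (raw)]:
  assumes "f \<in> borel_measurable M" "g \<in> M \<rightarrow>\<^sub>M circle_seq"
  shows "(\<lambda>x. sphere_walk B n (f x) (g x)) \<in> borel_measurable M"
  using measurable_compose[OF measurable_Pair[OF assms] sphere_walk_measurable_pair] by simp

text \<open>
Integration over a sequence of independent angles, the first angle split off.
\<close>

lemma nn_integral_circle_seq:
  assumes [measurable]: "F \<in> borel_measurable circle_seq"
  shows "(\<integral>\<^sup>+\<omega>. F \<omega> \<partial>circle_seq) = (\<integral>\<^sup>+s. (\<integral>\<^sup>+\<omega>. F (case_nat s \<omega>) \<partial>circle_seq) \<partial>circle_param)"
proof -
  have m: "(\<lambda>(s, \<omega>). case_nat s \<omega>) \<in> circle_param \<Otimes>\<^sub>M circle_seq \<rightarrow>\<^sub>M circle_seq"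
  proof (rule measurable_PiM_single')
    fix i :: nat
    show "(\<lambda>p. (case p of (s, \<omega>) \<Rightarrow> case_nat s \<omega>) i) \<in> circle_param \<Otimes>\<^sub>M circle_seq \<rightarrow>\<^sub>M circle_param"
      by (cases i) (simp_all add: case_prod_beta measurable_fst''
          measurable_compose[OF measurable_snd measurable_component_singleton])
  qed (auto simp: space_PiM)
  have "(\<integral>\<^sup>+\<omega>. F \<omega> \<partial>circle_seq)
      = (\<integral>\<^sup>+\<omega>. F \<omega> \<partial>distr (circle_param \<Otimes>\<^sub>M circle_seq) circle_seq (\<lambda>(s, \<omega>). case_nat s \<omega>))"
    by (simp add: circle_seq.PiM_iter)
  also have "\<dots> = (\<integral>\<^sup>+p. F ((\<lambda>(s, \<omega>). case_nat s \<omega>) p) \<partial>(circle_param \<Otimes>\<^sub>M circle_seq))"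
    by (rule nn_integral_distr[OF m]) simp
  also have "\<dots> = (\<integral>\<^sup>+s. (\<integral>\<^sup>+\<omega>. F (case_nat s \<omega>) \<partial>circle_seq) \<partial>circle_param)"
    by (subst circle_seq.nn_integral_fst[symmetric]) (use measurable_compose[OF m] in \<open>auto simp: case_prod_beta\<close>)
  finally show ?thesis .
qed

lemma nn_integral_walk_Suc:
  assumes [measurable]: "f \<in> borel_measurable borel"
  shows "(\<integral>\<^sup>+\<omega>. f (sphere_walk B (Suc n) z \<omega>) \<partial>circle_seq)
     = (\<integral>\<^sup>+s. (\<integral>\<^sup>+\<omega>. f (sphere_walk B n (sphere_step B z s) \<omega>) \<partial>circle_seq) \<partial>circle_param)"
proof -
  have "(\<lambda>\<omega>. f (sphere_walk B (Suc n) z \<omega>)) \<in> borel_measurable circle_seq"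
    by (intro measurable_compose[OF sphere_walk_measurable assms]) auto
  from nn_integral_circle_seq[OF this] show ?thesis by simp
qed

text \<open>
The mean of the kernel does not increase along the walk.
\<close>

lemma sphere_walk_superharmonic:
  assumes "\<And>z \<theta>. z \<in> V \<Longrightarrow> sphere_step B z \<theta> \<in> V"
    and "\<And>z. z \<in> V \<Longrightarrow> 2 * max (dist w z) (infdist z B / 2) \<le> exp C"
    and "z \<in> V"
  shows "(\<integral>\<^sup>+\<omega>. log_kernel C w (sphere_walk B n z \<omega>) \<partial>circle_seq) \<le> log_kernel C w z"
  using assms(3)
proof (induction n arbitrary: z)
  case 0
  then show ?case by (simp add: circle_seq.emeasure_space_1)
next
  case (Suc n)
  have "(\<integral>\<^sup>+\<omega>. log_kernel C w (sphere_walk B (Suc n) z \<omega>) \<partial>circle_seq)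
     = (\<integral>\<^sup>+s. (\<integral>\<^sup>+\<omega>. log_kernel C w (sphere_walk B n (sphere_step B z s) \<omega>) \<partial>circle_seq) \<partial>circle_param)"
    by (rule nn_integral_walk_Suc) measurable
  also have "\<dots> \<le> (\<integral>\<^sup>+s. log_kernel C w (sphere_step B z s) \<partial>circle_param)"
    by (intro nn_integral_mono Suc.IH assms(1) Suc.prems)
  also have "\<dots> \<le> log_kernel C w z"
  proof (cases "infdist z B = 0")
    case True
    then show ?thesis by (simp add: sphere_step_def circle_param.emeasure_space_1[simplified])
  next
    case False
    then have r: "0 < infdist z B / 2" using infdist_nonneg[of z B] by simp
    have "(\<integral>\<^sup>+s. log_kernel C w (sphere_step B z s) \<partial>circle_param) \<le> ennreal (C - ln (max (dist w z) (infdist z B / 2)))"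
      unfolding sphere_step_def by (rule circle_mean_kernel[OF r assms(2)[OF Suc.prems]])
    also have "\<dots> \<le> log_kernel C w z"
      by (auto simp: log_kernel_def intro!: ennreal_leI ln_mono)
    finally show ?thesis .
  qed
  finally show ?case .
qed

text \<open>
The mean square length of step \<open>n + 1\<close>.
\<close>

definition walk_increment :: "complex set \<Rightarrow> nat \<Rightarrow> complex \<Rightarrow> ennreal"
  where "walk_increment B n z = (\<integral>\<^sup>+\<omega>. ennreal ((infdist (sphere_walk B n z \<omega>) B / 2)\<^sup>2) \<partial>circle_seq)"

lemma walk_increment_Suc:
  "walk_increment B (Suc n) z = (\<integral>\<^sup>+s. walk_increment B n (sphere_step B z s) \<partial>circle_param)"
  unfolding walk_increment_def by (rule nn_integral_walk_Suc) measurable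

lemma walk_increment_measurable [measurable]: "walk_increment B n \<in> borel_measurable borel"
proof -
  have "(\<lambda>p. ennreal ((infdist (sphere_walk B n (fst p) (snd p)) B / 2)\<^sup>2)) \<in> borel_measurable (borel \<Otimes>\<^sub>M circle_seq)"
    using measurable_compose[OF sphere_walk_measurable_pair, of "\<lambda>z. ennreal ((infdist z B / 2)\<^sup>2)" borel] by simp
  then show ?thesis unfolding walk_increment_def
    by (intro circle_seq.borel_measurable_nn_integral) (simp add: case_prod_beta)
qed

text \<open>
The steps are orthogonal in \<open>L\<^sup>2\<close>, so the mean squares of their lengths add up.
\<close>

lemma walk_second_moment:
  "(\<integral>\<^sup>+\<omega>. ennreal ((dist (sphere_walk B n z \<omega>) c)\<^sup>2) \<partial>circle_seq)
     = ennreal ((dist z c)\<^sup>2) + (\<Sum>k<n. walk_increment B k z)"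
proof (induction n arbitrary: z)
  case 0
  then show ?case by (simp add: circle_seq.emeasure_space_1)
next
  case (Suc n)
  have "(\<integral>\<^sup>+\<omega>. ennreal ((dist (sphere_walk B (Suc n) z \<omega>) c)\<^sup>2) \<partial>circle_seq)
     = (\<integral>\<^sup>+s. ennreal ((dist (sphere_step B z s) c)\<^sup>2) + (\<Sum>k<n. walk_increment B k (sphere_step B z s)) \<partial>circle_param)"
    by (subst nn_integral_walk_Suc) (auto simp: Suc.IH)
  also have "\<dots> = (\<integral>\<^sup>+s. ennreal ((dist (sphere_step B z s) c)\<^sup>2) \<partial>circle_param)
      + (\<Sum>k<n. \<integral>\<^sup>+s. walk_increment B k (sphere_step B z s) \<partial>circle_param)"
    by (subst nn_integral_add) (auto simp: nn_integral_sum)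
  also have "(\<integral>\<^sup>+s. ennreal ((dist (sphere_step B z s) c)\<^sup>2) \<partial>circle_param) = ennreal ((dist z c)\<^sup>2) + walk_increment B 0 z"
    unfolding sphere_step_def by (subst circle_mean_square) (simp add: walk_increment_def circle_seq.emeasure_space_1)
  finally show ?case
    by (simp add: walk_increment_Suc[symmetric] sum.lessThan_Suc_shift add.assoc del: sum.lessThan_Suc sphere_walk.simps)
qed

lemma walk_square_difference:
  "(\<integral>\<^sup>+\<omega>. ennreal ((dist (sphere_walk B (n + m) z \<omega>) (sphere_walk B n z \<omega>))\<^sup>2) \<partial>circle_seq)
     = (\<Sum>k<m. walk_increment B (n + k) z)"
proof (induction n arbitrary: z)
  case 0
  then show ?case by (simp add: walk_second_moment)
next
  case (Suc n)
  have "(\<lambda>\<omega>. ennreal ((dist (sphere_walk B (Suc n + m) z \<omega>) (sphere_walk B (Suc n) z \<omega>))\<^sup>2)) \<in> borel_measurable circle_seq"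
    by (intro measurable_compose[OF _ measurable_ennreal] borel_measurable_power borel_measurable_dist sphere_walk_measurable) auto
  from nn_integral_circle_seq[OF this] show ?case
    by (simp add: Suc.IH walk_increment_Suc nn_integral_sum del: sum.lessThan_Suc)
qed

section \<open>Harmonic measure\<close>

lemma walk_in_region:
  assumes "\<And>z \<theta>. z \<in> V \<Longrightarrow> sphere_step B z \<theta> \<in> V" "z \<in> V"
  shows "sphere_walk B n z \<omega> \<in> V"
  using assms(2) by (induction n arbitrary: z \<omega>) (auto intro: assms(1))

text \<open>
A walk confined to a bounded region \<open>V\<close> has bounded second moments, hence summable mean
square increments. So it is Cauchy in \<open>L\<^sup>1\<close>, a subsequence converges almost
surely, and the limit lies on \<open>B\<close> because the step lengths, half the distances to
\<open>B\<close>, tend to \<open>0\<close>. The law of the limit inherits the bound on the potential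
by Fatou's lemma.
\<close>

lemma exists_harmonic_measure:
  assumes step: "\<And>z \<theta>. z \<in> V \<Longrightarrow> sphere_step B z \<theta> \<in> V"
    and V: "V \<subseteq> cball 0 R" and C: "4 * R \<le> exp C"
    and B: "closed B" "B \<noteq> {}" "B \<subseteq> cball 0 R" and z: "z \<in> V"
  obtains \<nu> where "prob_space \<nu>" "sets \<nu> = sets borel" "emeasure \<nu> (- B) = 0"
    "\<And>w. w \<in> cball 0 R \<Longrightarrow> log_pot C \<nu> w \<le> log_kernel C w z"
proof -
  let ?P = "circle_seq"
  let ?X = "\<lambda>n. sphere_walk B n z"
  have XV: "?X n \<omega> \<in> V" for n \<omega> using step z by (rule walk_in_region)
  have X_bound: "cmod (?X n \<omega>) \<le> R" for n \<omega> using XV[of n \<omega>] V by auto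
  have [measurable]: "?X n \<in> borel_measurable ?P" for n by (intro sphere_walk_measurable) auto
  have total: "(\<Sum>k<n. walk_increment B k z) \<le> ennreal (R\<^sup>2)" for n
  proof -
    have "(\<Sum>k<n. walk_increment B k z) \<le> (\<integral>\<^sup>+\<omega>. ennreal ((dist (?X n \<omega>) 0)\<^sup>2) \<partial>?P)"
      unfolding walk_second_moment by (rule add_increasing) auto
    also have "\<dots> \<le> (\<integral>\<^sup>+\<omega>. ennreal (R\<^sup>2) \<partial>?P)"
      using X_bound by (intro nn_integral_mono ennreal_leI power_mono) auto
    finally show ?thesis by (simp add: circle_seq.emeasure_space_1)
  qed
  have fin: "walk_increment B k z < \<infinity>" for k
  proof -
    have "walk_increment B k z \<le> (\<Sum>k<Suc k. walk_increment B k z)" by (simp add: add_increasing)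
    then show ?thesis using total[of "Suc k"] by (metis ennreal_less_top infinity_ennreal_def le_less_trans)
  qed
  define d where "d k = enn2real (walk_increment B k z)" for k
  have d: "walk_increment B k z = ennreal (d k)" "d k \<ge> 0" for k
    using fin[of k] by (auto simp: d_def)
  have "(\<Sum>k<n. d k) \<le> R\<^sup>2" for n
    using total[of n] d by (simp add: sum_ennreal)
  then have summable: "summable d"
    by (intro summableI_nonneg_bounded[of d "R\<^sup>2"] d)
  have int: "integrable ?P (?X n)" for n
    by (rule circle_seq.integrable_const_bound[of _ R]) (use X_bound in auto)
  have cauchy_L1: "\<exists>N. \<forall>i\<ge>N. \<forall>j\<ge>N. (\<integral>\<omega>. norm (?X i \<omega> - ?X j \<omega>) \<partial>?P) < e" if e: "e > 0" for e :: real
  proof -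
    have "e\<^sup>2 / 2 > 0" using e by simp
    from summable_partial_sum_bound[OF summable this]
    obtain N where N: "\<And>m n. m \<ge> N \<Longrightarrow> norm (\<Sum>k=m..n. d k) < e\<^sup>2 / 2" by blast
    have le: "(\<integral>\<omega>. norm (?X (i + m) \<omega> - ?X i \<omega>) \<partial>?P) < e" if "i \<ge> N" for i m
    proof -
      have int2: "integrable ?P (\<lambda>\<omega>. (dist (?X (i + m) \<omega>) (?X i \<omega>))\<^sup>2)"
      proof (rule circle_seq.integrable_const_bound[of _ "(2 * R)\<^sup>2"])
        show "AE \<omega> in ?P. norm ((dist (?X (i + m) \<omega>) (?X i \<omega>))\<^sup>2) \<le> (2 * R)\<^sup>2"
        proof (intro AE_I2)
          fix \<omega>
          have "dist (?X (i + m) \<omega>) (?X i \<omega>) \<le> 2 * R"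
            using norm_triangle_ineq4[of "?X (i + m) \<omega>" "?X i \<omega>"] X_bound[of "i+m" \<omega>] X_bound[of i \<omega>] by (simp add: dist_norm)
          then show "norm ((dist (?X (i + m) \<omega>) (?X i \<omega>))\<^sup>2) \<le> (2 * R)\<^sup>2"
            using power_mono[OF _ zero_le_dist, of _ _ _ 2] by fastforce
        qed
      qed measurable
      have "ennreal (\<integral>\<omega>. (dist (?X (i + m) \<omega>) (?X i \<omega>))\<^sup>2 \<partial>?P) = ennreal (\<Sum>k<m. d (i + k))"
        using walk_square_difference[of B i m z] d
        by (simp add: nn_integral_eq_integral[OF int2] sum_ennreal)
      then have "(\<integral>\<omega>. (dist (?X (i + m) \<omega>) (?X i \<omega>))\<^sup>2 \<partial>?P) = (\<Sum>k<m. d (i + k))"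
        using d by (subst (asm) ennreal_inj) (auto intro: sum_nonneg)
      also have "\<dots> \<le> (\<Sum>k=i..i+m. d k)"
      proof -
        have "(\<Sum>k<m. d (i + k)) = (\<Sum>k=i..<i+m. d k)"
          using sum.shift_bounds_nat_ivl[of d 0 i m] by (simp add: add.commute lessThan_atLeast0)
        also have "\<dots> \<le> (\<Sum>k=i..i+m. d k)" using d by (intro sum_mono2) auto
        finally show ?thesis .
      qed
      also have "\<dots> < e\<^sup>2 / 2" using N[OF that, of "i+m"] by simp
      finally have sq: "(\<integral>\<omega>. (dist (?X (i + m) \<omega>) (?X i \<omega>))\<^sup>2 \<partial>?P) < e\<^sup>2 / 2" .
      have "(\<integral>\<omega>. norm (?X (i + m) \<omega> - ?X i \<omega>) \<partial>?P)
         \<le> (\<integral>\<omega>. e / 2 + (dist (?X (i + m) \<omega>) (?X i \<omega>))\<^sup>2 / (2 * e) \<partial>?P)"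
      proof (rule integral_mono)
        \<comment> \<open>An elementary substitute for the Cauchy-Schwarz inequality: \<open>x \<le> e / 2 + x\<^sup>2 / (2 e)\<close>.\<close>
        fix \<omega>
        have "0 \<le> (dist (?X (i + m) \<omega>) (?X i \<omega>) - e)\<^sup>2" by simp
        then show "norm (?X (i + m) \<omega> - ?X i \<omega>) \<le> e / 2 + (dist (?X (i + m) \<omega>) (?X i \<omega>))\<^sup>2 / (2 * e)"
          using e by (simp add: dist_norm power2_eq_square field_simps)
      qed (use int int2 in auto)
      also have "\<dots> = e / 2 + (\<integral>\<omega>. (dist (?X (i + m) \<omega>) (?X i \<omega>))\<^sup>2 \<partial>?P) / (2 * e)"
        using int2 circle_seq.emeasure_space_1 by (simp add: measure_def)
      also have "\<dots> < e / 2 + (e\<^sup>2 / 2) / (2 * e)"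
        using sq e by (intro add_strict_left_mono divide_strict_right_mono) auto
      also have "\<dots> \<le> e" using e by (simp add: power2_eq_square field_simps)
      finally show ?thesis .
    qed
    show ?thesis
    proof (intro exI allI impI)
      fix i j assume "i \<ge> N" "j \<ge> N"
      then show "(\<integral>\<omega>. norm (?X i \<omega> - ?X j \<omega>) \<partial>?P) < e"
        using le[of i "j - i"] le[of j "i - j"] by (cases "i \<le> j") (auto simp: norm_minus_commute)
    qed
  qed
  obtain r where r: "strict_mono r" "AE \<omega> in ?P. Cauchy (\<lambda>i. ?X (r i) \<omega>)"
    using cauchy_L1_AE_cauchy_subseq[of ?P ?X, OF int cauchy_L1] by blast
  define Y where "Y \<omega> = lim (\<lambda>i. ?X (r i) \<omega>)" for \<omega>
  have [measurable]: "Y \<in> borel_measurable ?P"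
    unfolding Y_def by (rule borel_measurable_lim_metric) measurable
  have lim: "AE \<omega> in ?P. (\<lambda>i. ?X (r i) \<omega>) \<longlonglongrightarrow> Y \<omega>"
    using r(2) by eventually_elim (simp add: Y_def Cauchy_convergent_iff convergent_LIMSEQ_iff)
  have "(\<integral>\<^sup>+\<omega>. ennreal ((infdist (Y \<omega>) B / 2)\<^sup>2) \<partial>?P)
      = (\<integral>\<^sup>+\<omega>. liminf (\<lambda>i. ennreal ((infdist (?X (r i) \<omega>) B / 2)\<^sup>2)) \<partial>?P)"
  proof (rule nn_integral_cong_AE)
    show "AE \<omega> in ?P. ennreal ((infdist (Y \<omega>) B / 2)\<^sup>2) = liminf (\<lambda>i. ennreal ((infdist (?X (r i) \<omega>) B / 2)\<^sup>2))"
      using lim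
    proof eventually_elim
      case (elim \<omega>)
      show ?case
        by (intro lim_imp_Liminf[symmetric] tendsto_ennrealI tendsto_intros tendsto_infdist elim) auto
    qed
  qed
  also have "\<dots> \<le> liminf (\<lambda>i. walk_increment B (r i) z)"
    unfolding walk_increment_def by (rule nn_integral_liminf) measurable
  also have "\<dots> = 0"
  proof -
    have "(\<lambda>i. d (r i)) \<longlonglongrightarrow> 0"
      using LIMSEQ_subseq_LIMSEQ[OF summable_LIMSEQ_zero[OF summable] r(1)] by (simp add: o_def)
    then have "(\<lambda>i. walk_increment B (r i) z) \<longlonglongrightarrow> ennreal 0"
      unfolding d(1) by (rule tendsto_ennrealI)
    then show ?thesis using lim_imp_Liminf[of sequentially "\<lambda>i. walk_increment B (r i) z" 0] by simp
  qed
  finally have "(\<integral>\<^sup>+\<omega>. ennreal ((infdist (Y \<omega>) B / 2)\<^sup>2) \<partial>?P) = 0" by simp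
  then have "AE \<omega> in ?P. ennreal ((infdist (Y \<omega>) B / 2)\<^sup>2) = 0"
    by (subst (asm) nn_integral_0_iff_AE) auto
  then have YB: "AE \<omega> in ?P. Y \<omega> \<in> B"
    by eventually_elim (use B in \<open>simp add: in_closed_iff_infdist_zero\<close>)
  define \<nu> where "\<nu> = distr ?P borel Y"
  show thesis
  proof (rule that[of \<nu>])
    show "prob_space \<nu>" unfolding \<nu>_def by (rule circle_seq.prob_space_distr) measurable
    show "sets \<nu> = sets borel" by (simp add: \<nu>_def)
    have "AE x in \<nu>. x \<in> B"
      unfolding \<nu>_def using YB B by (subst AE_distr_iff) auto
    then show "emeasure \<nu> (- B) = 0"
      using B by (subst (asm) AE_iff_measurable[of "- B"]) (auto simp: \<nu>_def)
    fix w :: complex assume w: "w \<in> cball 0 R"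
    have max: "2 * max (dist w x) (infdist x B / 2) \<le> exp C" if "x \<in> V" for x
    proof -
      have tri: "dist w y \<le> 2 * R" if "w \<in> cball 0 R" "y \<in> cball 0 R" for w y :: complex
        using that dist_triangle[of w y 0] by (simp add: dist_commute)
      obtain b where b: "b \<in> B" using B by blast
      have "infdist x B \<le> 2 * R" using infdist_le[OF b, of x] tri[of x b] \<open>x \<in> V\<close> V b B by force
      moreover have "dist w x \<le> 2 * R" using tri w \<open>x \<in> V\<close> V by blast
      moreover have "0 \<le> R" using w by (simp, meson norm_ge_zero order_trans)
      ultimately show ?thesis using C by simp
    qed
    have "log_pot C \<nu> w = (\<integral>\<^sup>+\<omega>. log_kernel C w (Y \<omega>) \<partial>?P)"
      unfolding log_pot_def \<nu>_def by (subst nn_integral_distr) auto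
    also have "\<dots> = (\<integral>\<^sup>+\<omega>. liminf (\<lambda>i. log_kernel C w (?X (r i) \<omega>)) \<partial>?P)"
    proof (rule nn_integral_cong_AE)
      show "AE \<omega> in ?P. log_kernel C w (Y \<omega>) = liminf (\<lambda>i. log_kernel C w (?X (r i) \<omega>))"
        using lim
      proof eventually_elim
        case (elim \<omega>)
        show ?case by (intro lim_imp_Liminf[symmetric] tendsto_log_kernel elim tendsto_const) auto
      qed
    qed
    also have "\<dots> \<le> liminf (\<lambda>i. \<integral>\<^sup>+\<omega>. log_kernel C w (?X (r i) \<omega>) \<partial>?P)"
      by (rule nn_integral_liminf) measurable
    also have "\<dots> \<le> liminf (\<lambda>i. log_kernel C w z)"
      by (intro Liminf_mono always_eventually allI sphere_walk_superharmonic[OF step max z])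
    also have "\<dots> = log_kernel C w z" by (simp add: Liminf_const)
    finally show "log_pot C \<nu> w \<le> log_kernel C w z" .
  qed
qed

section \<open>The outer domain and its boundary\<close>

text \<open>
The finite points of the component of infinity.
\<close>

definition outer_domain :: "complex set \<Rightarrow> complex set"
  where "outer_domain K = Some -` Omega K"

lemma connected_subset_outer_domain:
  assumes "connected A" "A \<inter> K = {}" "A \<inter> outer_domain K \<noteq> {}"
  shows "A \<subseteq> outer_domain K"
proof -
  let ?X = "subtopology riemann_sphere (- Some ` K)"
  have "connectedin riemann_sphere (Some ` A)"
    unfolding riemann_sphere_def
    by (rule connectedin_continuous_map_image[OF continuous_map_Some]) (simp add: assms(1))
  then have conn: "connectedin ?X (Some ` A)"
    using assms(2) by (auto simp: connectedin_subtopology)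
  obtain a where a: "a \<in> A" "Some a \<in> connected_component_of_set ?X None"
    using assms(3) unfolding outer_domain_def Omega_def by blast
  have "connected_component_of ?X None (Some a)" using a(2) unfolding mem_Collect_eq .
  then have "connected_component_of ?X None = connected_component_of ?X (Some a)"
    by (rule iffD1[OF connected_component_of_equiv, THEN conjunct2, THEN conjunct2])
  then have "connected_component_of_set ?X None = connected_component_of_set ?X (Some a)" by simp
  moreover have "Some ` A \<subseteq> connected_component_of_set ?X (Some a)"
    using conn imageI[OF a(1)] by (rule connected_component_of_maximal)
  ultimately have "Some ` A \<subseteq> Omega K" unfolding Omega_def by blast
  then show ?thesis unfolding outer_domain_def by blast
qed

lemma outside_ball_subset_outer_domain:
  assumes "K \<subseteq> cball 0 R"
  shows "- cball 0 R \<subseteq> outer_domain K"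
proof -
  let ?X = "subtopology riemann_sphere (- Some ` K)"
  let ?S = "Some ` (- cball (0::complex) R)"
  have "connected (- cball (0::complex) R)"
    by (rule connected_complement_bounded_convex) auto
  then have "connectedin riemann_sphere ?S"
    unfolding riemann_sphere_def
    by (intro connectedin_continuous_map_image[OF continuous_map_Some]) simp
  then have "connectedin riemann_sphere (insert None ?S)"
  proof (rule connectedin_intermediate_closure_of)
    have "None \<in> riemann_sphere closure_of ?S"
      unfolding in_closure_of
    proof (intro conjI allI impI)
      fix W assume W: "None \<in> W \<and> openin riemann_sphere W"
      then obtain D where D: "compact D" "W = insert None (Some ` (- D))"
        unfolding riemann_sphere_def openin_Alexandroff_compactification
        by (auto simp: Compl_eq_Diff_UNIV)
      have "bounded (D \<union> cball 0 R)" using D compact_imp_bounded by auto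
      then obtain x where "x \<notin> D \<union> cball 0 R" using not_bounded_UNIV by (metis UNIV_eq_I)
      then show "\<exists>y. y \<in> ?S \<and> y \<in> W" using D by auto
    qed (simp add: riemann_sphere_def)
    then show "insert None ?S \<subseteq> riemann_sphere closure_of ?S"
      using closure_of_subset[of ?S riemann_sphere] by (auto simp: riemann_sphere_def)
  qed auto
  then have "connectedin ?X (insert None ?S)"
    using assms by (auto simp: connectedin_subtopology)
  then have "insert None ?S \<subseteq> Omega K"
    unfolding Omega_def by (rule connected_component_of_maximal) simp
  then show ?thesis unfolding outer_domain_def by blast
qed

lemma outer_domain_Int: "outer_domain K \<inter> K = {}"
proof -
  have "Omega K \<subseteq> - Some ` K"
    using connected_component_of_subset_topspace[of "subtopology riemann_sphere (- Some ` K)" None]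
    unfolding Omega_def by auto
  then show ?thesis unfolding outer_domain_def by blast
qed

lemma open_outer_domain:
  assumes "closed K"
  shows "open (outer_domain K)"
  unfolding open_contains_ball
proof
  fix z assume z: "z \<in> outer_domain K"
  then have "z \<in> - K" using outer_domain_Int by blast
  then obtain e where "e > 0" "ball z e \<subseteq> - K"
    using assms by (meson open_Compl open_contains_ball)
  moreover have "z \<in> ball z e" using \<open>e > 0\<close> by simp
  moreover have "ball z e \<subseteq> outer_domain K"
    using calculation z by (intro connected_subset_outer_domain connected_ball) blast+
  ultimately show "\<exists>e>0. ball z e \<subseteq> outer_domain K" by blast
qed

lemma boundary_Omega_eq:
  assumes "closed K"
  shows "boundary_Omega K = frontier (outer_domain K)"
proof -
  let ?O = "outer_domain K"
  have "Some z \<in> riemann_sphere interior_of Omega K \<longleftrightarrow> z \<in> ?O" for z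
  proof
    assume "Some z \<in> riemann_sphere interior_of Omega K"
    then show "z \<in> ?O" using interior_of_subset by (force simp: outer_domain_def)
  next
    assume "z \<in> ?O"
    have "openin riemann_sphere (Some ` ?O)"
      unfolding riemann_sphere_def using open_outer_domain[OF assms]
      by (subst openin_Alexandroff_compactification_image_Some) simp
    then have "Some ` ?O \<subseteq> riemann_sphere interior_of Omega K"
      by (intro interior_of_maximal) (auto simp: outer_domain_def)
    with \<open>z \<in> ?O\<close> show "Some z \<in> riemann_sphere interior_of Omega K" by blast
  qed
  moreover have "Some z \<in> riemann_sphere closure_of Omega K \<longleftrightarrow> z \<in> closure ?O" for z
  proof
    assume *: "Some z \<in> riemann_sphere closure_of Omega K"
    show "z \<in> closure ?O"
    proof (rule ccontr)
      assume "z \<notin> closure ?O"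
      then have "Some z \<in> Some ` (- closure ?O)" by simp
      moreover have "openin riemann_sphere (Some ` (- closure ?O))"
        unfolding riemann_sphere_def by (subst openin_Alexandroff_compactification_image_Some) (simp add: open_Compl)
      moreover have "\<forall>W. Some z \<in> W \<and> openin riemann_sphere W \<longrightarrow> (\<exists>y. y \<in> Omega K \<and> y \<in> W)"
        using * unfolding in_closure_of by (rule conjunct2)
      ultimately have "\<exists>y. y \<in> Omega K \<and> y \<in> Some ` (- closure ?O)" by simp
      then obtain y where "y \<in> Omega K" "y \<in> Some ` (- closure ?O)" by (elim exE conjE)
      then show False using closure_subset[of ?O] by (auto simp: outer_domain_def)
    qed
  next
    assume z: "z \<in> closure ?O"
    show "Some z \<in> riemann_sphere closure_of Omega K"
      unfolding in_closure_of
    proof (intro conjI allI impI)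
      fix W assume W: "Some z \<in> W \<and> openin riemann_sphere W"
      then have "open (Some -` W)"
        using openin_continuous_map_preimage[OF continuous_map_Some, of euclidean W]
        by (simp add: riemann_sphere_def vimage_def)
      then obtain y where "y \<in> ?O" "y \<in> Some -` W"
        using z W open_Int_closure_eq_empty[of "Some -` W" ?O] by (auto simp: vimage_def)
      then show "\<exists>y. y \<in> Omega K \<and> y \<in> W" by (auto simp: outer_domain_def)
    qed (simp add: riemann_sphere_def)
  qed
  ultimately show ?thesis
    unfolding boundary_Omega_def frontier_of_def frontier_def interior_open[OF open_outer_domain[OF assms]]
    by blast
qed

lemma boundary_Omega_subset:
  assumes "closed K"
  shows "boundary_Omega K \<subseteq> K"
proof
  fix z assume "z \<in> boundary_Omega K"
  then have z: "z \<in> closure (outer_domain K)" "z \<notin> outer_domain K"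
    unfolding boundary_Omega_eq[OF assms] frontier_def interior_open[OF open_outer_domain[OF assms]] by blast+
  show "z \<in> K"
  proof (rule ccontr)
    assume "z \<notin> K"
    then obtain e where e: "e > 0" "ball z e \<subseteq> - K"
      using assms by (meson ComplI open_Compl open_contains_ball)
    then have ze: "z \<in> ball z e" by simp
    then have "ball z e \<inter> outer_domain K \<noteq> {}"
      using z(1) open_Int_closure_eq_empty[of "ball z e" "outer_domain K"] by blast
    then have "ball z e \<subseteq> outer_domain K"
      using e by (intro connected_subset_outer_domain connected_ball) blast+
    then show False using z(2) ze by blast
  qed
qed

text \<open>
The open set enclosed by the outer boundary: the bounded components of the complement of that
boundary. It contains every point of \<open>K\<close> that is not on the outer boundary.
\<close>

definition inner_region :: "complex set \<Rightarrow> complex set"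
  where "inner_region K = - closure (outer_domain K)"

lemma inner_region_subset:
  assumes "K \<subseteq> cball 0 R"
  shows "inner_region K \<subseteq> cball 0 R"
  using outside_ball_subset_outer_domain[OF assms] closure_subset[of "outer_domain K"]
  unfolding inner_region_def by blast

lemma subset_boundary_Un_inner:
  assumes "closed K"
  shows "K \<subseteq> boundary_Omega K \<union> inner_region K"
  using outer_domain_Int[of K]
  unfolding boundary_Omega_eq[OF assms] frontier_def inner_region_def interior_open[OF open_outer_domain[OF assms]]
  by blast

lemma frontier_inner_region:
  assumes "closed K"
  shows "frontier (inner_region K) \<subseteq> boundary_Omega K"
proof -
  have "frontier (inner_region K) = closure (outer_domain K) - interior (closure (outer_domain K))"
    unfolding inner_region_def frontier_complement by (simp add: frontier_def)
  also have "\<dots> \<subseteq> frontier (outer_domain K)"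
    using interior_mono[OF closure_subset[of "outer_domain K"]] unfolding frontier_def by blast
  finally show ?thesis by (simp add: boundary_Omega_eq[OF assms])
qed

lemma inner_region_step:
  assumes "closed K" and z: "z \<in> inner_region K" and ne: "boundary_Omega K \<noteq> {}"
  shows "0 < infdist z (boundary_Omega K)"
    and "sphere_step (boundary_Omega K) z \<theta> \<in> inner_region K"
proof -
  let ?B = "boundary_Omega K"
  have cl: "closed ?B" by (simp add: boundary_Omega_eq[OF assms(1)])
  have "z \<notin> ?B" using z unfolding inner_region_def boundary_Omega_eq[OF assms(1)] frontier_def by blast
  then show pos: "0 < infdist z ?B" using cl ne by (simp add: infdist_pos_not_in_closed)
  let ?D = "cball z (infdist z ?B / 2)"
  have "?D \<inter> ?B = {}"
  proof -
    have "x \<notin> ?B" if "x \<in> ?D" for x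
      using that infdist_le[of x ?B z] pos by auto
    then show ?thesis by blast
  qed
  then have "?D \<inter> frontier (inner_region K) = {}" using frontier_inner_region[OF assms(1)] by blast
  moreover have "z \<in> ?D \<inter> inner_region K" using z pos by auto
  ultimately have "?D \<subseteq> inner_region K"
    using connected_Int_frontier[of ?D "inner_region K"] by blast
  moreover have "sphere_step ?B z \<theta> \<in> ?D"
    using pos by (simp add: sphere_step_def dist_norm norm_mult)
  ultimately show "sphere_step ?B z \<theta> \<in> inner_region K" by blast
qed

context energy_minimizer
begin

context
  assumes large: "4 * R \<le> exp C"
begin

lemma boundary_nonempty:
  assumes "z \<in> inner_region K"
  shows "boundary_Omega K \<noteq> {}"
proof
  assume "boundary_Omega K = {}"
  then have "frontier (inner_region K) = {}" using frontier_inner_region[OF closed_K] by simp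
  then have "inner_region K = UNIV" using assms frontier_eq_empty by blast
  then have "bounded (UNIV :: complex set)"
    using inner_region_subset[OF K_cball] bounded_subset[OF bounded_cball] by metis
  then show False by simp
qed

text \<open>
Inside the outer boundary the potential is at least the energy, by the variational inequality for
harmonic measure.
\<close>

lemma energy_le_log_pot_inner:
  assumes x: "x \<in> inner_region K"
  shows "log_en C \<mu> \<le> log_pot C \<mu> x"
proof -
  let ?B = "boundary_Omega K"
  have ne: "?B \<noteq> {}" using x by (rule boundary_nonempty)
  have cl: "closed ?B" by (simp add: boundary_Omega_eq[OF closed_K])
  have BK: "?B \<subseteq> K" by (rule boundary_Omega_subset[OF closed_K])
  have B_ball: "?B \<subseteq> cball 0 R" using BK K_cball by blast
  obtain \<nu> where \<nu>: "prob_space \<nu>" "sets \<nu> = sets borel" "emeasure \<nu> (- ?B) = 0"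
    "\<And>w. w \<in> cball 0 R \<Longrightarrow> log_pot C \<nu> w \<le> log_kernel C w x"
    using exists_harmonic_measure[OF inner_region_step(2)[OF closed_K _ ne] inner_region_subset[OF K_cball] large cl ne B_ball x]
    by blast
  have "emeasure \<nu> (- K) \<le> emeasure \<nu> (- ?B)" using BK cl \<nu>(2) by (intro emeasure_mono) auto
  then have \<nu>K: "\<nu> \<in> unit_measures_on K"
    using \<nu> by (simp add: unit_measures_on_def unit_borel_measure_def)
  have AE_B: "AE w in \<nu>. w \<in> ?B" by (rule AE_I[of _ _ "- ?B"]) (use \<nu> cl in auto)
  have "log_en C \<nu> \<le> (\<integral>\<^sup>+w. ennreal (C - ln (infdist x ?B)) \<partial>\<nu>)"
    unfolding log_en_def
  proof (rule nn_integral_mono_AE)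
    show "AE w in \<nu>. log_pot C \<nu> w \<le> ennreal (C - ln (infdist x ?B))"
      using AE_B
    proof eventually_elim
      case (elim w)
      have pos: "0 < infdist x ?B" by (rule inner_region_step(1)[OF closed_K x ne])
      have le: "infdist x ?B \<le> dist w x" using infdist_le[OF elim, of x] by (simp add: dist_commute)
      have "log_pot C \<nu> w \<le> log_kernel C w x" using \<nu>(4) elim B_ball by blast
      also have "\<dots> \<le> ennreal (C - ln (infdist x ?B))"
        using pos le by (auto simp: log_kernel_def intro!: ennreal_leI ln_mono)
      finally show ?case .
    qed
  qed
  also have "\<dots> < \<infinity>" using prob_space.emeasure_space_1[OF \<nu>(1)] by simp
  finally have "log_en C \<mu> \<le> (\<integral>\<^sup>+w. log_pot C \<mu> w \<partial>\<nu>)"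
    by (rule energy_le_integral_log_pot[OF \<nu>K])
  also have "\<dots> = (\<integral>\<^sup>+w. log_pot C \<nu> w \<partial>\<mu>)"
    using \<nu>(1,2) by (intro log_pot_swap sets_\<mu> sigma_finite_measure_axioms prob_space_imp_sigma_finite) auto
  also have "\<dots> \<le> (\<integral>\<^sup>+w. log_kernel C x w \<partial>\<mu>)"
    using AE_K by (intro nn_integral_mono_AE, eventually_elim) (use \<nu>(4) K_cball in \<open>auto simp: log_kernel_commute[of C x]\<close>)
  finally show ?thesis by (simp add: log_pot_def)
qed

text \<open>
At a point \<open>y\<close> of the support inside the outer boundary, the potential would be
strictly larger than its mean over a small circle, which is at least the energy, whereas at a point
of the support the potential is at most the energy.
\<close>

lemma supp_Int_inner: "T \<inter> inner_region K = {}"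
proof (rule ccontr)
  assume "T \<inter> inner_region K \<noteq> {}"
  then obtain y where y: "y \<in> T" "y \<in> inner_region K" by blast
  let ?B = "boundary_Omega K"
  have ne: "?B \<noteq> {}" using y(2) by (rule boundary_nonempty)
  define r where "r = infdist y ?B / 2"
  have r: "r > 0" unfolding r_def using inner_region_step(1)[OF closed_K y(2) ne] by simp
  have step: "y + of_real r * cis (2 * pi * \<theta>) \<in> inner_region K" for \<theta>
    using inner_region_step(2)[OF closed_K y(2) ne] by (simp add: sphere_step_def r_def)
  have max: "2 * max (dist w y) r \<le> exp C" if "w \<in> cball 0 R" for w
  proof -
    have tri: "dist u v \<le> 2 * R" if "u \<in> cball 0 R" "v \<in> cball 0 R" for u v :: complex
      using that dist_triangle[of u v 0] by (simp add: dist_commute)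
    have yR: "y \<in> cball 0 R" using y(2) inner_region_subset[OF K_cball] by blast
    have "r = dist y (y + of_real r * cis (2 * pi * 0))" using r by (simp add: dist_norm)
    also have "\<dots> \<le> 2 * R" using yR step[of 0] inner_region_subset[OF K_cball] by (intro tri) auto
    finally show ?thesis using tri[OF that yR] large by simp
  qed
  let ?m = "\<lambda>w. ennreal (C - ln (max (dist w y) r))"
  interpret P: pair_sigma_finite circle_param \<mu>
    by unfold_locales
  have "log_en C \<mu> = (\<integral>\<^sup>+\<theta>. log_en C \<mu> \<partial>circle_param)" by (simp add: circle_param.emeasure_space_1[simplified])
  also have "\<dots> \<le> (\<integral>\<^sup>+\<theta>. log_pot C \<mu> (y + of_real r * cis (2 * pi * \<theta>)) \<partial>circle_param)"
    by (intro nn_integral_mono energy_le_log_pot_inner step)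
  also have "\<dots> = (\<integral>\<^sup>+w. (\<integral>\<^sup>+\<theta>. log_kernel C w (y + of_real r * cis (2 * pi * \<theta>)) \<partial>circle_param) \<partial>\<mu>)"
    unfolding log_pot_def log_kernel_commute[of C "y + _"]
    by (rule P.Fubini'[symmetric]) (simp add: case_prod_beta)
  also have "\<dots> \<le> (\<integral>\<^sup>+w. ?m w \<partial>\<mu>)"
    using AE_K
  proof (intro nn_integral_mono_AE, eventually_elim)
    case (elim w)
    then show ?case using K_cball by (intro circle_mean_kernel r max) blast
  qed
  finally have le: "log_en C \<mu> \<le> (\<integral>\<^sup>+w. ?m w \<partial>\<mu>)" .
  have mk: "?m w \<le> log_kernel C y w" for w
    by (auto simp: log_kernel_def dist_commute intro!: ennreal_leI ln_mono)
  have "(\<integral>\<^sup>+w. ?m w \<partial>\<mu>) < (\<integral>\<^sup>+w. log_kernel C y w \<partial>\<mu>)"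
  proof (rule nn_integral_less)
    have "(\<integral>\<^sup>+w. ?m w \<partial>\<mu>) \<le> log_pot C \<mu> y" unfolding log_pot_def by (intro nn_integral_mono mk)
    also have "\<dots> < \<infinity>" using log_pot_le_supp[OF y(1)] finite by (rule le_less_trans)
    finally show "(\<integral>\<^sup>+w. ?m w \<partial>\<mu>) \<noteq> \<infinity>" by simp
    show "\<not> (AE w in \<mu>. log_kernel C y w \<le> ?m w)"
    proof
      assume "AE w in \<mu>. log_kernel C y w \<le> ?m w"
      then have "AE w in \<mu>. w \<notin> ball y r"
      proof eventually_elim
        case (elim w)
        show ?case
        proof
          assume w: "w \<in> ball y r"
          have "ln (2 * r) \<le> ln (exp C)"
            using max[of y] r y(2) inner_region_subset[OF K_cball] by (intro ln_mono) auto
          then have pos: "C - ln r > 0" using r by (simp add: ln_mult_pos) (smt (verit) ln_gt_zero)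
          have "w \<noteq> y" using elim by (auto simp: log_kernel_def top_unique)
          moreover have "ln (dist y w) < ln r" using w r \<open>w \<noteq> y\<close> by (intro ln_less_cancel_iff[THEN iffD2]) auto
          then have "ennreal (C - ln r) < ennreal (C - ln (dist y w))"
            using pos by (intro ennreal_lessI) auto
          ultimately show False using elim w by (auto simp: log_kernel_def dist_commute max_def split: if_splits)
        qed
      qed
      then have "emeasure \<mu> (ball y r) = 0" by (simp add: AE_iff_measurable[OF _ refl] ball_def)
      moreover have "emeasure \<mu> (ball y r) > 0" using y(1) r by (auto simp: measure_supp_def)
      ultimately show False by simp
    qed
  qed (use mk in \<open>auto\<close>)
  also have "\<dots> \<le> log_en C \<mu>" using log_pot_le_supp[OF y(1)] by (simp add: log_pot_def)
  finally show False using le by simp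
qed

theorem AE_boundary: "AE w in \<mu>. w \<in> boundary_Omega K"
  using AE_T by eventually_elim (use supp_Int_inner T_subset subset_boundary_Un_inner[OF closed_K] in blast)

end

end

section \<open>Logarithmic integrals of monic polynomials\<close>

context energy_minimizer
begin

lemma AE_poly_nonzero:
  assumes "P \<noteq> 0"
  shows "AE z in \<mu>. poly P z \<noteq> 0"
proof -
  have "AE z in \<mu>. \<forall>x\<in>{x. poly P x = 0}. z \<noteq> x"
    using poly_roots_finite[OF assms] AE_neq by (intro AE_finite_allI) auto
  then show ?thesis by eventually_elim auto
qed

lemma integral_ln_prod:
  "integrable \<mu> (\<lambda>z. ln (cmod (poly (\<Prod>x\<in>#A. [:-x, 1:]) z)))
   \<and> real (size A) * (C - energy) \<le> (\<integral>z. ln (cmod (poly (\<Prod>x\<in>#A. [:-x, 1:]) z)) \<partial>\<mu>)"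
proof (induction A)
  case (add x A)
  let ?Q = "\<Prod>x\<in>#A. [:-x, 1:]"
  have "?Q \<noteq> 0" by (auto simp: prod_mset_zero_iff)
  then have AE: "AE z in \<mu>. ln (dist x z) + ln (cmod (poly ?Q z)) = ln (cmod (poly (\<Prod>x\<in>#add_mset x A. [:-x, 1:]) z))"
    using AE_poly_nonzero[of ?Q] AE_neq[of x]
  proof (elim eventually_elim2)
    fix z assume z: "poly ?Q z \<noteq> 0" "z \<noteq> x"
    have "cmod (poly (\<Prod>x\<in>#add_mset x A. [:-x, 1:]) z) = dist x z * cmod (poly ?Q z)"
    proof -
      have "poly (\<Prod>x\<in>#add_mset x A. [:-x, 1:]) z = (z - x) * poly ?Q z" by (simp add: algebra_simps)
      then show ?thesis by (simp add: norm_mult dist_norm norm_minus_commute)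
    qed
    then show "ln (dist x z) + ln (cmod (poly ?Q z)) = ln (cmod (poly (\<Prod>x\<in>#add_mset x A. [:-x, 1:]) z))"
      using z by (simp add: ln_mult_pos)
  qed
  have int: "integrable \<mu> (\<lambda>z. ln (dist x z) + ln (cmod (poly ?Q z)))"
    using add integrable_ln_dist' by (intro Bochner_Integration.integrable_add) auto
  have m: "(\<lambda>z. ln (cmod (poly P z))) \<in> borel_measurable \<mu>" for P
  proof -
    have [measurable]: "poly P \<in> borel_measurable borel"
      by (intro borel_measurable_continuous_onI continuous_intros)
    show ?thesis by measurable
  qed
  have "integrable \<mu> (\<lambda>z. ln (cmod (poly (\<Prod>x\<in>#add_mset x A. [:-x, 1:]) z)))"
    by (rule integrable_cong_AE_imp[OF int m AE])
  moreover have "(\<integral>z. ln (cmod (poly (\<Prod>x\<in>#add_mset x A. [:-x, 1:]) z)) \<partial>\<mu>)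
      = (\<integral>z. ln (dist x z) + ln (cmod (poly ?Q z)) \<partial>\<mu>)"
    by (intro integral_cong_AE m borel_measurable_integrable[OF int]) (use AE in \<open>eventually_elim, simp\<close>)
  moreover have "\<dots> = (\<integral>z. ln (dist x z) \<partial>\<mu>) + (\<integral>z. ln (cmod (poly ?Q z)) \<partial>\<mu>)"
    using add integrable_ln_dist' by (intro Bochner_Integration.integral_add) auto
  ultimately show ?case
    using add integral_ln_dist_ge[of x] by (simp add: algebra_simps)
qed simp

lemma integral_ln_monic:
  assumes "lead_coeff P = 1"
  shows "integrable \<mu> (\<lambda>z. ln (cmod (poly P z)))"
    and "real (degree P) * (C - energy) \<le> (\<integral>z. ln (cmod (poly P z)) \<partial>\<mu>)"
proof -
  have "P \<noteq> 0" using assms by auto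
  then obtain A where A: "size A = degree P" "P = smult (lead_coeff P) (\<Prod>x\<in>#A. [:-x, 1:])"
    using alg_closed_imp_factorization by blast
  then have "P = (\<Prod>x\<in>#A. [:-x, 1:])" using assms by simp
  with integral_ln_prod[of A] A(1)
  show "integrable \<mu> (\<lambda>z. ln (cmod (poly P z)))"
    "real (degree P) * (C - energy) \<le> (\<integral>z. ln (cmod (poly P z)) \<partial>\<mu>)" by metis+
qed

text \<open>
Jensen's inequality for \<open>|P|\<^sup>2 H\<close>, proved with the tangent \<open>exp m * (1 + (f
- m))\<close> of the exponential function at the mean \<open>m\<close> of \<open>f = ln (|P|\<^sup>2
H)\<close>.
\<close>

lemma weighted_L2_lower_bound:
  assumes P: "lead_coeff P = 1"
    and H [measurable]: "H \<in> borel_measurable borel" and pos: "AE z in \<mu>. 0 < H z"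
    and int: "integrable \<mu> (\<lambda>z. ln (H z))"
  shows "ennreal (exp ((\<integral>z. ln (H z) \<partial>\<mu>) + 2 * real (degree P) * (C - energy)))
     \<le> (\<integral>\<^sup>+z. ennreal ((cmod (poly P z))\<^sup>2) * ennreal (H z) \<partial>\<mu>)"
proof -
  have [measurable]: "poly P \<in> borel_measurable borel"
    by (intro borel_measurable_continuous_onI continuous_intros)
  let ?g = "\<lambda>z. (cmod (poly P z))\<^sup>2 * H z"
  define f where "f z = 2 * ln (cmod (poly P z)) + ln (H z)" for z
  define m where "m = (\<integral>z. f z \<partial>\<mu>)"
  have f: "integrable \<mu> f" unfolding f_def using integral_ln_monic(1)[OF P] int by auto
  have m: "(\<integral>z. ln (H z) \<partial>\<mu>) + 2 * real (degree P) * (C - energy) \<le> m"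
  proof -
    have "m = 2 * (\<integral>z. ln (cmod (poly P z)) \<partial>\<mu>) + (\<integral>z. ln (H z) \<partial>\<mu>)"
      unfolding m_def f_def using integral_ln_monic(1)[OF P] int by simp
    then show ?thesis using integral_ln_monic(2)[OF P] by simp
  qed
  have "P \<noteq> 0" using P by auto
  have lower: "AE z in \<mu>. exp m * (1 + (f z - m)) \<le> ?g z"
    using AE_poly_nonzero[OF \<open>P \<noteq> 0\<close>] pos
  proof eventually_elim
    case (elim z)
    have "exp m * (1 + (f z - m)) \<le> exp m * exp (f z - m)"
      by (intro mult_left_mono exp_ge_add_one_self) auto
    also have "\<dots> = exp (f z)" by (simp flip: exp_add)
    also have "\<dots> = ?g z"
      using elim unfolding f_def exp_add exp_double by simp
    finally show ?case .
  qed
  have eq: "(\<integral>\<^sup>+z. ennreal ((cmod (poly P z))\<^sup>2) * ennreal (H z) \<partial>\<mu>) = (\<integral>\<^sup>+z. ennreal (?g z) \<partial>\<mu>)"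
    by (intro nn_integral_cong) (simp add: ennreal_mult')
  show ?thesis
  proof (cases "(\<integral>\<^sup>+z. ennreal (?g z) \<partial>\<mu>) = \<infinity>")
    case False
    have nonneg: "AE z in \<mu>. 0 \<le> ?g z" using pos by eventually_elim auto
    have g: "integrable \<mu> ?g"
      using False nonneg by (intro integrableI_nonneg) (auto simp: less_top)
    have "exp m = (\<integral>z. exp m * (1 + (f z - m)) \<partial>\<mu>)"
      using f prob_UNIV by (simp add: m_def)
    also have "\<dots> \<le> (\<integral>z. ?g z \<partial>\<mu>)"
      using f by (intro integral_mono_AE lower g) auto
    finally have "ennreal (exp m) \<le> (\<integral>\<^sup>+z. ennreal (?g z) \<partial>\<mu>)"
      using nonneg by (subst nn_integral_eq_integral[OF g]) (auto intro: ennreal_leI)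
    moreover have "ennreal (exp ((\<integral>z. ln (H z) \<partial>\<mu>) + 2 * real (degree P) * (C - energy))) \<le> ennreal (exp m)"
      using m by (intro ennreal_leI) simp
    ultimately show ?thesis unfolding eq by (rule order_trans[rotated])
  next
    case True
    then show ?thesis unfolding eq by (metis infinity_ennreal_def top_greatest)
  qed
qed

end

text \<open>
If \<open>H\<close> has finite mass and its extended logarithmic integral is not
\<open>-\<infinity>\<close>, then \<open>H\<close> is positive almost everywhere and the integral is
that of the real logarithm.
\<close>

lemma ereal_integral_elog:
  assumes [measurable]: "H \<in> borel_measurable N" and fin: "(\<integral>\<^sup>+z. ennreal (H z) \<partial>N) < \<infinity>"
    and M: "- \<infinity> < ereal_integral N (\<lambda>z. elog (H z))"
  shows "AE z in N. 0 < H z" "integrable N (\<lambda>z. ln (H z))"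
    "ereal_integral N (\<lambda>z. elog (H z)) = ereal (\<integral>z. ln (H z) \<partial>N)"
proof -
  let ?pos = "\<integral>\<^sup>+z. e2ennreal (elog (H z)) \<partial>N" and ?neg = "\<integral>\<^sup>+z. e2ennreal (- elog (H z)) \<partial>N"
  have [measurable]: "(\<lambda>z. elog (H z)) \<in> borel_measurable N" unfolding elog_def by measurable
  have "?pos \<le> (\<integral>\<^sup>+z. ennreal (H z) \<partial>N)"
  proof (rule nn_integral_mono)
    fix z
    have "ln (H z) \<le> H z" if "0 < H z" using ln_le_minus_one[OF that] by simp
    then show "e2ennreal (elog (H z)) \<le> ennreal (H z)"
      by (cases "0 < H z") (simp_all add: elog_def e2ennreal_neg ennreal_leI)
  qed
  then have pos: "?pos < \<infinity>" using fin by (rule le_less_trans)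
  then obtain a where a: "?pos = ennreal a" "a \<ge> 0" by (metis ennreal_cases infinity_ennreal_def less_irrefl)
  have neg: "?neg < \<infinity>"
  proof (cases "?neg = \<infinity>")
    case True
    then have "ereal_integral N (\<lambda>z. elog (H z)) = - \<infinity>"
      unfolding ereal_integral_def a(1) using a(2) by (simp add: enn2ereal_ennreal)
    with M show ?thesis by simp
  qed (simp add: less_top)
  have "AE z in N. e2ennreal (- elog (H z)) \<noteq> \<infinity>"
    by (rule nn_integral_noteq_infinite[OF _ less_imp_neq[OF neg]]) measurable
  then show AE: "AE z in N. 0 < H z"
  proof eventually_elim
    case (elim z)
    then show ?case by (cases "0 < H z") (simp_all add: elog_def e2ennreal_infty)
  qed
  have eq: "?pos = (\<integral>\<^sup>+z. ennreal (ln (H z)) \<partial>N)" "?neg = (\<integral>\<^sup>+z. ennreal (- ln (H z)) \<partial>N)"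
    by (rule nn_integral_cong_AE, use AE in \<open>eventually_elim, simp add: elog_def\<close>)+
  show int: "integrable N (\<lambda>z. ln (H z))"
    unfolding real_integrable_def eq[symmetric] using pos neg by (intro conjI less_imp_neq[OF pos[folded infinity_ennreal_def]] less_imp_neq[OF neg]) measurable
  show "ereal_integral N (\<lambda>z. elog (H z)) = ereal (\<integral>z. ln (H z) \<partial>N)"
  proof -
    obtain b where b: "?neg = ennreal b" "b \<ge> 0" using neg by (metis ennreal_cases infinity_ennreal_def less_irrefl)
    have "(\<integral>z. ln (H z) \<partial>N) = a - b"
      unfolding real_lebesgue_integral_def[OF int] eq[symmetric] a(1) b(1) using a(2) b(2) by simp
    then show ?thesis
      unfolding ereal_integral_def a(1) b(1) using a(2) b(2) by (simp add: enn2ereal_ennreal)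
  qed
qed

section \<open>Existence and uniqueness of monic orthogonal polynomials\<close>

text \<open>
A measure for which polynomials are square integrable and the \<open>L\<^sup>2\<close> seminorm is
definite on them.
\<close>

locale poly_L2 =
  fixes \<rho> :: "complex measure"
  assumes integrable_poly: "\<And>P Q. integrable \<rho> (\<lambda>z. poly P z * cnj (poly Q z))"
    and definite: "\<And>P. P \<noteq> 0 \<Longrightarrow> 0 < (\<integral>z. (cmod (poly P z))\<^sup>2 \<partial>\<rho>)"
begin

text \<open>
The \<open>L\<^sup>2\<close> inner product of polynomials, linear in the first argument.
\<close>

definition ip :: "complex poly \<Rightarrow> complex poly \<Rightarrow> complex"
  where "ip P Q = (\<integral>z. poly P z * cnj (poly Q z) \<partial>\<rho>)"

lemma ip_add_left: "ip (P + P') Q = ip P Q + ip P' Q"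
  unfolding ip_def poly_add distrib_right by (rule Bochner_Integration.integral_add[OF integrable_poly integrable_poly])

lemma ip_add_right: "ip P (Q + Q') = ip P Q + ip P Q'"
  unfolding ip_def poly_add complex_cnj_add distrib_left by (rule Bochner_Integration.integral_add[OF integrable_poly integrable_poly])

lemma ip_smult_left: "ip (smult c P) Q = c * ip P Q"
  unfolding ip_def poly_smult mult.assoc by (rule Bochner_Integration.integral_mult_right_zero)

lemma ip_smult_right: "ip P (smult c Q) = cnj c * ip P Q"
  unfolding ip_def poly_smult complex_cnj_mult mult.left_commute[of _ "cnj c"] by (rule Bochner_Integration.integral_mult_right_zero)

lemma ip_diff_left: "ip (P - P') Q = ip P Q - ip P' Q"
  unfolding ip_def poly_diff left_diff_distrib by (rule Bochner_Integration.integral_diff[OF integrable_poly integrable_poly])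

lemma ip_commute: "ip Q P = cnj (ip P Q)"
proof -
  have "cnj (ip P Q) = (\<integral>z. cnj (poly P z * cnj (poly Q z)) \<partial>\<rho>)"
    unfolding ip_def by (rule Bochner_Integration.integral_cnj[symmetric])
  then show ?thesis by (simp add: ip_def mult.commute)
qed

lemma ip_self: "ip P P = of_real ((L2_norm_poly \<rho> P)\<^sup>2)"
proof -
  have "ip P P = (\<integral>z. of_real ((cmod (poly P z))\<^sup>2) \<partial>\<rho>)"
    unfolding ip_def by (simp add: complex_norm_square[symmetric])
  also have "\<dots> = of_real (\<integral>z. (cmod (poly P z))\<^sup>2 \<partial>\<rho>)" by (rule integral_complex_of_real)
  finally show ?thesis by (simp add: L2_norm_poly_def)
qed

lemma L2_pos: "P \<noteq> 0 \<Longrightarrow> 0 < L2_norm_poly \<rho> P"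
  unfolding L2_norm_poly_def by (simp only: real_sqrt_gt_0_iff definite not_False_eq_True)

lemma monic_of_low_degree:
  assumes "\<forall>i\<ge>n. coeff q i = 0"
  shows "monom 1 n - q \<in> monic_polys n"
proof -
  have "coeff (monom 1 n - q) n = 1" using assms by simp
  moreover have "degree (monom 1 n - q) \<le> n"
    using assms by (intro degree_le) auto
  ultimately have "degree (monom 1 n - q) = n"
    by (metis le_antisym le_degree zero_neq_one)
  with \<open>coeff _ n = 1\<close> show ?thesis by (simp add: monic_polys_def)
qed

text \<open>
Orthogonal projection onto the polynomials of degree less than \<open>n\<close>, described by
vanishing coefficients so that the zero polynomial needs no special treatment. In the induction step
the projection of the monomial of degree \<open>n\<close> supplies the next orthogonal polynomial
\<open>p\<close>.
\<close>

lemma orthogonal_projection: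
  "\<exists>q. (\<forall>i\<ge>n. coeff q i = 0) \<and> (\<forall>r. (\<forall>i\<ge>n. coeff r i = 0) \<longrightarrow> ip (f - q) r = 0)"
proof (induction n arbitrary: f)
  case 0
  have "r = 0" if "\<forall>i\<ge>0. coeff r i = 0" for r :: "complex poly" using that by (simp add: poly_eq_iff)
  then have "ip (f - 0) r = 0" if "\<forall>i\<ge>0. coeff r i = 0" for r :: "complex poly"
    using that by (metis ip_smult_right mult_zero_left complex_cnj_zero smult_0_left)
  then show ?case by (intro exI[of _ 0]) simp
next
  case (Suc n)
  obtain q0 where q0: "\<forall>i\<ge>n. coeff q0 i = 0" "\<And>r. \<forall>i\<ge>n. coeff r i = 0 \<Longrightarrow> ip (monom 1 n - q0) r = 0"
    using Suc.IH[of "monom 1 n"] by blast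
  obtain q1 where q1: "\<forall>i\<ge>n. coeff q1 i = 0" "\<And>r. \<forall>i\<ge>n. coeff r i = 0 \<Longrightarrow> ip (f - q1) r = 0"
    using Suc.IH[of f] by blast
  define p where "p = monom 1 n - q0"
  have p_coeff: "coeff p n = 1" "\<forall>i>n. coeff p i = 0" using q0(1) by (auto simp: p_def)
  then have "p \<noteq> 0" by auto
  then have pp: "ip p p \<noteq> 0" using L2_pos[of p] by (simp add: ip_self)
  define c where "c = ip (f - q1) p / ip p p"
  define q where "q = q1 + smult c p"
  have low: "\<forall>i\<ge>Suc n. coeff q i = 0" using q1(1) p_coeff(2) by (simp add: q_def)
  have fq: "ip (f - q) r = ip (f - q1) r - c * ip p r" for r
    unfolding q_def by (simp add: ip_diff_left ip_add_left ip_smult_left)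
  have "ip (f - q) r = 0" if r: "\<forall>i\<ge>Suc n. coeff r i = 0" for r
  proof -
    define r' where "r' = r - smult (coeff r n) p"
    have "coeff r' i = 0" if "i \<ge> n" for i
      using that r p_coeff by (cases "i = n") (auto simp: r'_def)
    then have r': "\<forall>i\<ge>n. coeff r' i = 0" by blast
    have "r = smult (coeff r n) p + r'" by (simp add: r'_def)
    then have "ip (f - q) r = cnj (coeff r n) * ip (f - q) p + ip (f - q) r'"
      by (metis ip_add_right ip_smult_right)
    also have "ip (f - q) p = 0" unfolding fq using pp by (simp add: c_def)
    also have "ip (f - q) r' = 0" unfolding fq using q1(2)[OF r'] q0(2)[OF r'] by (simp add: p_def)
    finally show ?thesis by simp
  qed
  with low show ?case by blast
qed

lemma monic_OP_in_monic_polys: "monic_OP \<rho> n \<in> monic_polys n"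
proof -
  obtain q where q: "\<forall>i\<ge>n. coeff q i = 0" "\<And>r. \<forall>i\<ge>n. coeff r i = 0 \<Longrightarrow> ip (monom 1 n - q) r = 0"
    using orthogonal_projection[of n "monom 1 n"] by blast
  define p where "p = monom 1 n - q"
  have p: "p \<in> monic_polys n" unfolding p_def using q(1) by (rule monic_of_low_degree)
  have pythagoras: "(L2_norm_poly \<rho> Q)\<^sup>2 = (L2_norm_poly \<rho> p)\<^sup>2 + (L2_norm_poly \<rho> (Q - p))\<^sup>2"
    if Q: "Q \<in> monic_polys n" for Q
  proof -
    have "coeff (Q - p) i = 0" if "i \<ge> n" for i
    proof (cases "i = n")
      case True
      have "coeff Q n = 1" "coeff p n = 1" using Q p unfolding monic_polys_def mem_Collect_eq by metis+
      then show ?thesis using True by simp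
    next
      case False
      then have "i > degree Q" "i > degree p" using that Q p unfolding monic_polys_def by auto
      then show ?thesis by (simp add: coeff_eq_0)
    qed
    then have orth: "ip p (Q - p) = 0" unfolding p_def by (intro q(2)) blast
    then have orth': "ip (Q - p) p = 0" using ip_commute[of "Q - p" p] by simp
    have "ip Q Q = ip (p + (Q - p)) (p + (Q - p))" by simp
    also have "\<dots> = ip p p + ip (Q - p) (Q - p)"
      unfolding ip_add_left ip_add_right orth orth' by simp
    finally have "complex_of_real ((L2_norm_poly \<rho> Q)\<^sup>2) = of_real ((L2_norm_poly \<rho> p)\<^sup>2 + (L2_norm_poly \<rho> (Q - p))\<^sup>2)"
      by (simp only: ip_self of_real_add)
    then show ?thesis unfolding of_real_eq_iff .
  qed
  have nonneg: "0 \<le> L2_norm_poly \<rho> Q" for Q by (simp add: L2_norm_poly_def)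
  have le: "L2_norm_poly \<rho> p \<le> L2_norm_poly \<rho> Q" if "Q \<in> monic_polys n" for Q
    by (rule power2_le_imp_le[OF _ nonneg]) (simp only: pythagoras[OF that] le_add_same_cancel1 zero_le_power2)
  have inf: "(INF Q\<in>monic_polys n. L2_norm_poly \<rho> Q) = L2_norm_poly \<rho> p"
    by (rule cInf_eq_minimum) (use p le in blast)+
  have "monic_OP \<rho> n = p"
    unfolding monic_OP_def
  proof (rule the_equality)
    fix Q assume Q: "Q \<in> monic_polys n \<and> L2_norm_poly \<rho> Q = (INF Q\<in>monic_polys n. L2_norm_poly \<rho> Q)"
    then have "L2_norm_poly \<rho> Q = L2_norm_poly \<rho> p" unfolding inf by blast
    then have "L2_norm_poly \<rho> (Q - p) = 0" using pythagoras[of Q] Q by simp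
    then show "Q = p" using L2_pos[of "Q - p"] by (metis eq_iff_diff_eq_0 less_irrefl)
  qed (simp only: p inf simp_thms)
  with p show ?thesis by simp
qed

end

section \<open>The lower bound for the Widom factors\<close>

lemma unit_measures_on_mono:
  assumes "A \<subseteq> B" "closed A"
  shows "unit_measures_on A \<subseteq> unit_measures_on B"
proof
  fix \<nu> assume \<nu>: "\<nu> \<in> unit_measures_on A"
  then have "emeasure \<nu> (- B) \<le> emeasure \<nu> (- A)"
    using assms by (intro emeasure_mono) (auto simp: unit_measures_on_def unit_borel_measure_def)
  with \<nu> show "\<nu> \<in> unit_measures_on B" by (simp add: unit_measures_on_def)
qed

lemma log_capacity_eq_minimum:
  assumes "\<nu> \<in> unit_measures_on K" "\<And>\<nu>'. \<nu>' \<in> unit_measures_on K \<Longrightarrow> log_energy \<nu> \<le> log_energy \<nu>'"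
  shows "log_capacity K = real_of_ereal (eexp (- log_energy \<nu>))"
proof -
  have "(INF \<nu>\<in>unit_measures_on K. log_energy \<nu>) = log_energy \<nu>"
    using assms by (intro antisym INF_lower INF_greatest) auto
  then show ?thesis by (simp add: log_capacity_def)
qed

text \<open>
The equilibrium measure of a non-polar compact set fits the locale, and its support has capacity
\<open>exp (C - energy)\<close>. With \<open>C = ln (4 R)\<close>, twice the distance between two
points of the disc is at most \<open>exp C\<close>, as the circle means require.
\<close>

lemma equilibrium_energy_minimizer:
  assumes K: "compact K" "non_polar K" and eq: "is_equilibrium_measure K \<mu>"
  obtains C R where "energy_minimizer K \<mu> C R" "4 * R \<le> exp C"
    "log_capacity (measure_supp \<mu>) = exp (C - enn2real (log_en C \<mu>))"
proof -
  obtain a where a: "\<And>x. x \<in> K \<Longrightarrow> norm x \<le> a"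
    using compact_imp_bounded[OF K(1)] unfolding bounded_iff by blast
  define R where "R = max a 1"
  define C where "C = ln (4 * R)"
  have R: "R \<ge> 1" "K \<subseteq> cball 0 R" using a by (auto simp: R_def le_max_iff_disj)
  have C: "exp C = 4 * R" "C \<ge> 0" using R(1) by (auto simp: C_def)
  have \<mu>: "\<mu> \<in> unit_measures_on K" and min: "\<And>\<nu>. \<nu> \<in> unit_measures_on K \<Longrightarrow> log_energy \<mu> \<le> log_energy \<nu>"
    using eq by (auto simp: is_equilibrium_measure_def)
  have en: "log_energy \<nu> = enn2ereal (log_en C \<nu>) - ereal C" if \<nu>: "\<nu> \<in> unit_measures_on K" for \<nu>
  proof (rule log_energy_eq)
    show "AE z in \<nu>. cmod z \<le> R"
      using AE_unit_measures_on[OF \<nu> compact_imp_closed[OF K(1)]] by eventually_elim (use R(2) in auto)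
  qed (use prob_sets_unit_measures_on[OF \<nu>] C R in auto)
  have cap: "log_capacity K = real_of_ereal (eexp (- log_energy \<mu>))"
    using \<mu> min by (rule log_capacity_eq_minimum)
  have fin: "log_en C \<mu> < \<infinity>"
  proof (rule ccontr)
    assume "\<not> ?thesis"
    then have "log_en C \<mu> = top" by (simp add: not_less top_unique)
    then have "log_energy \<mu> = \<infinity>" using en[OF \<mu>] by (simp add: top_ereal_def)
    then have "log_capacity K = 0" unfolding cap by (simp add: eexp_def)
    with K(2) show False by (simp add: non_polar_def)
  qed
  have EM: "energy_minimizer K \<mu> C R"
  proof
    fix \<nu> assume \<nu>: "\<nu> \<in> unit_measures_on K"
    have "enn2ereal (log_en C \<mu>) - ereal C \<le> enn2ereal (log_en C \<nu>) - ereal C"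
      using min[OF \<nu>] en[OF \<nu>] en[OF \<mu>] by simp
    then have "enn2ereal (log_en C \<mu>) \<le> enn2ereal (log_en C \<nu>)"
      by (cases "enn2ereal (log_en C \<mu>)"; cases "enn2ereal (log_en C \<nu>)") auto
    then show "log_en C \<mu> \<le> log_en C \<nu>" by (simp add: less_eq_ennreal.rep_eq)
  qed (use K R C \<mu> fin in auto)
  interpret energy_minimizer K \<mu> C R by (rule EM)
  have "log_energy \<mu> = ereal (energy - C)"
    using en[OF \<mu>] energy_nonneg by (simp add: log_en_eq enn2ereal_ennreal)
  moreover have "log_capacity (measure_supp \<mu>) = real_of_ereal (eexp (- log_energy \<mu>))"
  proof (rule log_capacity_eq_minimum)
    show "\<mu> \<in> unit_measures_on T"
      using \<mu> emeasure_compl_measure_supp[OF sets_\<mu>] by (simp add: unit_measures_on_def)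
    show "log_energy \<mu> \<le> log_energy \<nu>" if "\<nu> \<in> unit_measures_on T" for \<nu>
      using that min unit_measures_on_mono[OF T_subset closed_T] by blast
  qed
  ultimately have "log_capacity (measure_supp \<mu>) = exp (C - energy)"
    by (simp add: eexp_def)
  with EM show thesis using C(1) by (intro that[of C R]) (auto simp: energy_def)
qed

text \<open>
By scaling, definiteness needs to be known for monic polynomials only.
\<close>

lemma poly_L2_of_lower_bound:
  assumes "\<nu> \<in> unit_measures_on S" "compact S"
    and pos: "\<And>P. lead_coeff P = 1 \<Longrightarrow> 0 < (\<integral>\<^sup>+z. ennreal ((cmod (poly P z))\<^sup>2) \<partial>\<nu>)"
  shows "poly_L2 \<nu>"
proof -
  have [measurable_cong]: "sets \<nu> = sets borel" and "prob_space \<nu>"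
    using prob_sets_unit_measures_on[OF assms(1)] by auto
  interpret prob_space \<nu> by fact
  have AE: "AE z in \<nu>. z \<in> S"
    using AE_unit_measures_on[OF assms(1) compact_imp_closed[OF assms(2)]] .
  have int: "integrable \<nu> (\<lambda>z. poly P z * cnj (poly Q z))" for P Q
  proof -
    have cont: "continuous_on A (\<lambda>z. poly P z * cnj (poly Q z))" for A by (intro continuous_intros)
    then have "bounded ((\<lambda>z. poly P z * cnj (poly Q z)) ` S)"
      using assms(2) by (intro compact_imp_bounded compact_continuous_image)
    then obtain b where "\<And>z. z \<in> S \<Longrightarrow> norm (poly P z * cnj (poly Q z)) \<le> b"
      unfolding bounded_iff by blast
    moreover have [measurable]: "(\<lambda>z. poly P z * cnj (poly Q z)) \<in> borel_measurable borel"
      using cont by (rule borel_measurable_continuous_onI)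
    ultimately show ?thesis
      using AE by (intro integrable_const_bound[of _ b]) (auto elim!: eventually_mono)
  qed
  have sq: "integrable \<nu> (\<lambda>z. (cmod (poly P z))\<^sup>2)" for P
  proof -
    have "integrable \<nu> (\<lambda>z. Re (poly P z * cnj (poly P z)))" by (rule integrable_Re[OF int])
    then show ?thesis by (simp only: complex_norm_square[symmetric] Re_complex_of_real)
  qed
  show ?thesis
  proof
    show "integrable \<nu> (\<lambda>z. poly P z * cnj (poly Q z))" for P Q by (rule int)
    fix P :: "complex poly" assume P: "P \<noteq> 0"
    define Q where "Q = smult (inverse (lead_coeff P)) P"
    have Q: "lead_coeff Q = 1" using P by (simp add: Q_def)
    have PQ: "P = smult (lead_coeff P) Q" using P by (simp add: Q_def)
    have "ennreal 0 < ennreal (\<integral>z. (cmod (poly Q z))\<^sup>2 \<partial>\<nu>)"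
      using pos[OF Q] by (simp add: nn_integral_eq_integral[OF sq])
    then have "0 < (\<integral>z. (cmod (poly Q z))\<^sup>2 \<partial>\<nu>)" by (subst (asm) ennreal_less_iff) auto
    moreover have "(\<integral>z. (cmod (poly P z))\<^sup>2 \<partial>\<nu>) = (cmod (lead_coeff P))\<^sup>2 * (\<integral>z. (cmod (poly Q z))\<^sup>2 \<partial>\<nu>)"
      by (subst PQ) (simp add: norm_mult power_mult_distrib)
    ultimately show "0 < (\<integral>z. (cmod (poly P z))\<^sup>2 \<partial>\<nu>)" using P by simp
  qed
qed

theorem theorem1p3:
  fixes K S :: "complex set" and \<mu> \<mu>\<^sub>K \<mu>\<^sub>s :: "complex measure"
    and h :: "complex \<Rightarrow> real" and M :: ereal
  assumes "compact K" and "non_polar K"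
    and "is_equilibrium_measure K \<mu>\<^sub>K"
    and "compact S" and "boundary_Omega K \<subseteq> S" and "\<mu> \<in> unit_measures_on S"
    and "sets \<mu>\<^sub>s = sets borel" and "mutually_singular \<mu>\<^sub>K \<mu>\<^sub>s"
    and "h \<in> borel_measurable (restrict_space borel (boundary_Omega K))"
    and "\<And>z. z \<in> boundary_Omega K \<Longrightarrow> 0 \<le> h z"
    and "\<And>A. A \<in> sets borel \<Longrightarrow>
      emeasure \<mu> A = (\<integral>\<^sup>+z\<in>A \<inter> boundary_Omega K. ennreal (h z) \<partial>\<mu>\<^sub>K) + emeasure \<mu>\<^sub>s A"
    and "M = ereal_integral (restrict_space \<mu>\<^sub>K (boundary_Omega K)) (\<lambda>z. elog (h z))"
    and "M > -\<infinity>"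
    and "log_capacity (measure_supp \<mu>) = log_capacity (measure_supp \<mu>\<^sub>K)"
  shows "eexp M \<le> (INF n. ereal ((widom_factor n \<mu>)\<^sup>2))"
proof -
  obtain C R where EM: "energy_minimizer K \<mu>\<^sub>K C R" and large: "4 * R \<le> exp C"
    and cap: "log_capacity (measure_supp \<mu>\<^sub>K) = exp (C - enn2real (log_en C \<mu>\<^sub>K))"
    using equilibrium_energy_minimizer[OF assms(1-3)] by metis
  interpret energy_minimizer K \<mu>\<^sub>K C R by (rule EM)
  let ?B = "boundary_Omega K"
  have B [measurable]: "?B \<in> sets borel"
    by (simp add: boundary_Omega_eq[OF closed_K])
  have AE_B: "AE z in \<mu>\<^sub>K. z \<in> ?B" using large by (rule AE_boundary)
  have \<mu>_sets [measurable_cong]: "sets \<mu> = sets borel" and \<mu>_prob: "prob_space \<mu>"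
    using prob_sets_unit_measures_on[OF assms(6)] by auto
  define H where "H z = (if z \<in> ?B then h z else 0)" for z
  have H [measurable]: "H \<in> borel_measurable borel"
    unfolding H_def using assms(9) by (subst (asm) measurable_restrict_space_iff[where c=0]) auto
  \<comment> \<open>Discarding the singular part leaves the density \<open>H\<close> with respect to \<open>\<mu>\<^sub>K\<close>.\<close>
  have density_le: "density \<mu>\<^sub>K (\<lambda>z. ennreal (H z)) \<le> \<mu>"
  proof -
    have sets_eq: "sets (density \<mu>\<^sub>K (\<lambda>z. ennreal (H z))) = sets \<mu>" by (simp add: \<mu>_sets)
    have "emeasure (density \<mu>\<^sub>K (\<lambda>z. ennreal (H z))) \<le> emeasure \<mu>"
    proof (rule le_funI)
      fix A
      show "emeasure (density \<mu>\<^sub>K (\<lambda>z. ennreal (H z))) A \<le> emeasure \<mu> A"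
      proof (cases "A \<in> sets borel")
        case True
        have "emeasure (density \<mu>\<^sub>K (\<lambda>z. ennreal (H z))) A = (\<integral>\<^sup>+z\<in>A. ennreal (H z) \<partial>\<mu>\<^sub>K)"
          using True by (intro emeasure_density) auto
        also have "\<dots> = (\<integral>\<^sup>+z\<in>A \<inter> ?B. ennreal (h z) \<partial>\<mu>\<^sub>K)"
          by (intro nn_integral_cong) (simp add: H_def indicator_def)
        finally have "emeasure (density \<mu>\<^sub>K (\<lambda>z. ennreal (H z))) A = (\<integral>\<^sup>+z\<in>A \<inter> ?B. ennreal (h z) \<partial>\<mu>\<^sub>K)" .
        then show ?thesis unfolding assms(11)[OF True] by simp
      next
        case False
        then show ?thesis by (subst emeasure_notin_sets) auto
      qed
    qed
    with sets_eq sets_eq_imp_space_eq[OF sets_eq] show ?thesis by (simp add: le_measure_iff)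
  qed
  have nn_le: "(\<integral>\<^sup>+z. f z * ennreal (H z) \<partial>\<mu>\<^sub>K) \<le> (\<integral>\<^sup>+z. f z \<partial>\<mu>)" if [measurable]: "f \<in> borel_measurable borel" for f
  proof -
    have "(\<integral>\<^sup>+z. f z * ennreal (H z) \<partial>\<mu>\<^sub>K) = (\<integral>\<^sup>+z. f z \<partial>density \<mu>\<^sub>K (\<lambda>z. ennreal (H z)))"
      by (subst nn_integral_density) (auto simp: mult.commute)
    also have "\<dots> \<le> (\<integral>\<^sup>+z. f z \<partial>\<mu>)"
      using density_le by (intro nn_integral_mono_measure) (simp_all add: \<mu>_sets)
    finally show ?thesis .
  qed
  \<comment> \<open>The mass of \<open>H\<close> is at most that of the probability measure \<open>\<mu>\<close>, so the positive part of \<open>log H\<close> is integrable.\<close>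
  have H_fin: "(\<integral>\<^sup>+z. ennreal (H z) \<partial>\<mu>\<^sub>K) < \<infinity>"
    using nn_le[of "\<lambda>_. 1"] prob_space.emeasure_space_1[OF \<mu>_prob] by (auto intro: le_less_trans)
  \<comment> \<open>No mass is lost by the restriction to the outer boundary.\<close>
  have M: "M = ereal_integral \<mu>\<^sub>K (\<lambda>z. elog (H z))"
  proof -
    have "(\<integral>\<^sup>+z. e2ennreal (elog (h z)) \<partial>restrict_space \<mu>\<^sub>K ?B) = (\<integral>\<^sup>+z. e2ennreal (elog (H z)) \<partial>\<mu>\<^sub>K)"
      "(\<integral>\<^sup>+z. e2ennreal (- elog (h z)) \<partial>restrict_space \<mu>\<^sub>K ?B) = (\<integral>\<^sup>+z. e2ennreal (- elog (H z)) \<partial>\<mu>\<^sub>K)"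
      using AE_B by (subst nn_integral_restrict_space;
          auto intro!: nn_integral_cong_AE elim!: eventually_mono simp: H_def)+
    then show ?thesis unfolding assms(12) ereal_integral_def by simp
  qed
  define m where "m = (\<integral>z. ln (H z) \<partial>\<mu>\<^sub>K)"
  have H_meas: "H \<in> borel_measurable \<mu>\<^sub>K" by measurable
  note ln_H = ereal_integral_elog[OF H_meas H_fin assms(13)[unfolded M]]
  have Mm: "M = ereal m" using ln_H(3) by (simp add: M m_def)
  have lower: "ennreal (exp (m + 2 * real (degree P) * (C - energy))) \<le> (\<integral>\<^sup>+z. ennreal ((cmod (poly P z))\<^sup>2) \<partial>\<mu>)"
    if P: "lead_coeff P = 1" for P
  proof -
    have [measurable]: "poly P \<in> borel_measurable borel"
      by (intro borel_measurable_continuous_onI continuous_intros)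
    have "ennreal (exp (m + 2 * real (degree P) * (C - energy)))
        \<le> (\<integral>\<^sup>+z. ennreal ((cmod (poly P z))\<^sup>2) * ennreal (H z) \<partial>\<mu>\<^sub>K)"
      unfolding m_def by (rule weighted_L2_lower_bound[OF P H ln_H(1,2)])
    also have "\<dots> \<le> (\<integral>\<^sup>+z. ennreal ((cmod (poly P z))\<^sup>2) \<partial>\<mu>)" by (rule nn_le) measurable
    finally show ?thesis .
  qed
  have "poly_L2 \<mu>"
  proof (rule poly_L2_of_lower_bound[OF assms(6,4)])
    fix P :: "complex poly" assume "lead_coeff P = 1"
    then show "0 < (\<integral>\<^sup>+z. ennreal ((cmod (poly P z))\<^sup>2) \<partial>\<mu>)"
      using lower[of P] by (intro less_le_trans[OF _ lower]) simp_all
  qed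
  then interpret poly_L2 \<mu> .
  have "ereal (exp m) \<le> ereal ((widom_factor n \<mu>)\<^sup>2)" for n
  proof -
    define P where "P = monic_OP \<mu> n"
    have P: "lead_coeff P = 1" "degree P = n"
      using monic_OP_in_monic_polys[of n] unfolding monic_polys_def P_def by blast+
    have "integrable \<mu> (\<lambda>z. Re (poly P z * cnj (poly P z)))" by (rule integrable_Re[OF integrable_poly])
    then have int: "integrable \<mu> (\<lambda>z. (cmod (poly P z))\<^sup>2)"
      by (simp only: complex_norm_square[symmetric] Re_complex_of_real)
    have L2: "(L2_norm_poly \<mu> P)\<^sup>2 = (\<integral>z. (cmod (poly P z))\<^sup>2 \<partial>\<mu>)"
      by (simp add: L2_norm_poly_def)
    have "ennreal (exp (m + 2 * real n * (C - energy))) \<le> ennreal ((L2_norm_poly \<mu> P)\<^sup>2)"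
      using lower[OF P(1)] unfolding L2 P(2) by (simp add: nn_integral_eq_integral[OF int])
    then have "exp (m + 2 * real n * (C - energy)) \<le> (L2_norm_poly \<mu> P)\<^sup>2"
      by (subst (asm) ennreal_le_iff) auto
    moreover have "exp (m + 2 * real n * (C - energy)) = exp m * (exp (C - energy) ^ n)\<^sup>2"
      by (simp add: exp_add exp_of_nat_mult[symmetric] exp_double[symmetric] mult.assoc)
    ultimately have "exp m \<le> (L2_norm_poly \<mu> P)\<^sup>2 / (exp (C - energy) ^ n)\<^sup>2"
      by (simp add: pos_le_divide_eq)
    then show ?thesis
      unfolding widom_factor_def assms(14) cap energy_def[symmetric] P_def[symmetric] power_divide by simp
  qed
  then show ?thesis unfolding Mm by (intro INF_greatest) (simp add: eexp_def)
qed


end
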